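(* Let $n\ge 1$, $N=2n$. Let $\alpha$ and $\beta$ be independent random permutations of $[N]$, with $\alpha$ uniform on the set $\mathcal C_2$ of the $(N-1)!!$ fixed-point-free involutions of $[N]$ and $\beta$ uniform on the set $\mathcal C_N$ of the $(N-1)!$ $N$-cycles of $[N]$. Let $X_n$ be the number of cycles of $\gamma=\alpha\beta$. Then for every $\nu\in[1,N]$, \[ \mathrm P(X_n=\nu)=[x^Ny^{\nu}]\sum_{\lambda_1=1}^N(-1)^{\lambda^1}F(N,\lambda_1)\,[\xi^{\lambda_1}]\left[\frac{\xi}{1-\xi}\left(\frac{1-x}{1-x\xi}\right)^y\right], \] equivalently \[ \mathrm E[y^{X_n}]=\sum_{\lambda_1=1}^N(-1)^{\lambda^1}F(N,\lambda_1)\,[\xi^{\lambda_1}x^N]\left[\frac{\xi}{1-\xi}\left(\frac{1-x}{1-x\xi}\right)^y\right]. \]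
   Context: $[\cdot]$ denotes coefficient extraction in formal power series. For $1\le\lambda_1\le N$ set $\lambda^1=N+1-\lambda_1$. Define $F(N,\lambda_1)=(-1)^{(\lambda^1-1)/2}\binom{(N-2)/2}{(\lambda_1-2)/2}\big/\binom{N-1}{\lambda_1-1}$ if $\lambda_1$ is even, and $F(N,\lambda_1)=(-1)^{(\lambda^1+2)/2}\binom{(N-2)/2}{(\lambda_1-1)/2}\big/\binom{N-1}{\lambda_1-1}$ if $\lambda_1$ is odd. *)

theory Defs
  imports "HOL-Probability.Probability" "HOL-Combinatorics.Combinatorics"
          "HOL-Computational_Algebra.Formal_Power_Series"
begin

definition fpf_involutions :: "'a set \<Rightarrow> ('a \<Rightarrow> 'a) set" where
  "fpf_involutions S = {a. a permutes S \<and> (\<forall>i\<in>S. a (a i) = i \<and> a i \<noteq> i)}"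

definition full_cycles :: "'a set \<Rightarrow> ('a \<Rightarrow> 'a) set" where
  "full_cycles S = {b. b permutes S \<and> cyclic_on b S}"

definition num_cycles :: "'a set \<Rightarrow> ('a \<Rightarrow> 'a) \<Rightarrow> nat" where
  "num_cycles S g = card ((\<lambda>i. orbit g i) ` S)"

definition F :: "nat \<Rightarrow> nat \<Rightarrow> real" where
  "F N l = (let lu = N + 1 - l in
     if even l then (-1) ^ ((lu - 1) div 2) * real (((N - 2) div 2) choose ((l - 2) div 2))
                      / real ((N - 1) choose (l - 1))
     else (-1) ^ ((lu + 2) div 2) * real (((N - 2) div 2) choose ((l - 1) div 2))
                      / real ((N - 1) choose (l - 1)))"

text \<open>Bivariate power series as x-series with coefficients in real xi-series
  (xi = fps_X of the inner ring).  (1-x)^y and (1-x xi)^(-y) are given by the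
  binomial series, i.e. fps_binomial composed with -X (and substituting x xi).\<close>
definition one_minus_x_pow :: "real \<Rightarrow> real fps fps" where
  "one_minus_x_pow y = Abs_fps (\<lambda>a. fps_const (fps_nth (fps_binomial y oo (- fps_X)) a))"

definition one_minus_xxi_pow :: "real \<Rightarrow> real fps fps" where
  "one_minus_xxi_pow y =
     Abs_fps (\<lambda>b. fps_const (fps_nth (fps_binomial (- y) oo (- fps_X)) b) * fps_X ^ b)"

definition GF :: "real \<Rightarrow> real fps fps" where
  "GF y = fps_const (fps_X * inverse (1 - fps_X)) * one_minus_x_pow y * one_minus_xxi_pow y"

end

theory Submission
  imports Defs
begin

text \<open>
  A permutation \<open>b\<close> of an \<open>N\<close>-element set \<open>X\<close> is an \<open>N\<close>-cycle iff
  \<open>\<Sum> \<bar>S\<bar> (-1)^(number of cycles of b in S)\<close>, taken over the \<open>b\<close>-invariant \<open>S \<subseteq> X\<close>, does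
  not vanish, and then the sum is \<open>-N\<close>. Hence, for a fixed fixed-point-free involution \<open>a\<close>, the
  sum of \<open>y^(cycles of a b)\<close> over all \<open>N\<close>-cycles \<open>b\<close> becomes a signed sum over \<open>S\<close> and over
  \<open>b = p q\<close> with \<open>p \<in> Sym S\<close>, \<open>q \<in> Sym (X - S)\<close>. The contribution of \<open>S\<close> is \<open>0\<close> if at least
  two points of \<open>S\<close> have their partner outside \<open>S\<close>. If there is no such point, \<open>a\<close> is absorbed
  into \<open>p\<close> and \<open>q\<close> at the cost of a sign, and the sum factors into two rising factorials; if there
  is exactly one such point \<open>s\<close>, the only difference is that the transposition of \<open>s\<close> and \<open>a s\<close>
  merges one cycle of \<open>p\<close> with one of \<open>q\<close>. Counting these \<open>S\<close> gives an explicit combination of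
  products of rising factorials. On the other side, the coefficients of the generating function
  are partial sums of a Vandermonde convolution, which also have a product form.
  The number of \<open>N\<close>-cycles is the case \<open>y = 1\<close>.
\<close>

section \<open>Cycle counts and transpositions\<close>

lemma orbit_eqI_mem:
  assumes "permutation f" "x \<in> orbit f y"
  shows "orbit f x = orbit f y"
  using assms by (meson cyclic_on_orbit' orbit_cyclic_eq3)

lemma permutes_permutation:
  assumes "f permutes X" "finite X"
  shows "permutation f"
  using assms permutation_permutes by blast

lemma orbit_subset_closed:
  assumes "f x \<in> A" "\<And>y. y \<in> A \<Longrightarrow> f y \<in> A"
  shows "orbit f x \<subseteq> A"
proof
  fix y assume "y \<in> orbit f x"
  then show "y \<in> A" by induct (use assms in auto)
qed

text \<open>Starting at \<open>s\<close>, the composite runs through the \<open>f\<close>-orbit of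
  \<open>s\<close> until it would return to \<open>s\<close>; there it is diverted to
  \<open>t\<close> and goes on through the \<open>f\<close>-orbit of \<open>t\<close>. So the
  transposition merges the two orbits.\<close>

lemma orbit_transpose_comp:
  assumes "permutation f" "t \<notin> orbit f s"
  shows "orbit (Transposition.transpose s t \<circ> f) s = orbit f s \<union> orbit f t"
proof -
  let ?g = "Transposition.transpose s t \<circ> f"
  have g: "permutation ?g"
    by (intro permutation_compose permutation_swap_id assms)
  have bij: "bij f" using assms(1) permutation_bijective by blast
  \<comment> \<open>Stated for arbitrary \<open>u\<close> and \<open>v\<close>, since it is applied
    to \<open>s\<close>, \<open>t\<close> and also with the two exchanged.\<close>
  have half: "orbit f u \<subseteq> orbit (Transposition.transpose u v \<circ> f) u" "v \<in> orbit (Transposition.transpose u v \<circ> f) u"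
    if "v \<notin> orbit f u" for u v
  proof -
    let ?h = "Transposition.transpose u v \<circ> f"
    have h: "permutation ?h"
      by (intro permutation_compose permutation_swap_id assms)
    have step: "f z \<in> orbit ?h u" if "z \<in> orbit f u" "z \<in> orbit ?h u" for z
    proof (cases "f z = u")
      case True
      then show ?thesis using permutation_self_in_orbit[OF h] by simp
    next
      case False
      moreover have "f z \<noteq> v" using that(1) \<open>v \<notin> orbit f u\<close> orbit.step by metis
      ultimately have "?h z = f z" by simp
      then show ?thesis using that(2) orbit.step by metis
    qed
    have self: "u \<in> orbit ?h u" "u \<in> orbit f u"
      using permutation_self_in_orbit h assms(1) by metis+
    show sub: "orbit f u \<subseteq> orbit ?h u"
    proof
      fix z assume "z \<in> orbit f u"
      then show "z \<in> orbit ?h u"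
        by induct (blast intro: step self)+
    qed
    \<comment> \<open>The \<open>f\<close>-predecessor \<open>w\<close> of \<open>u\<close> is the
      point that the composite diverts to \<open>v\<close>.\<close>
    obtain w where w: "f w = u" using bij by (metis bij_pointE)
    have "w \<in> orbit f u"
      using self(2) assms(1) permutation_orbit_step[OF assms(1), of w] permutation_self_in_orbit[OF assms(1), of w] w by simp
    then have "w \<in> orbit ?h u" using sub by blast
    then have "?h w \<in> orbit ?h u" by (rule orbit.step)
    then show "v \<in> orbit ?h u" using w by simp
  qed
  have "s \<notin> orbit f t"
    using assms orbit_eqI_mem permutation_self_in_orbit by metis
  from half(1)[OF this] have "orbit f t \<subseteq> orbit ?g t" by (simp add: transpose_commute)
  moreover have "orbit ?g t = orbit ?g s"
    using half(2)[OF assms(2)] g orbit_eqI_mem by metis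
  ultimately have "orbit f s \<union> orbit f t \<subseteq> orbit ?g s"
    using half(1)[OF assms(2)] by auto
  moreover have "orbit ?g s \<subseteq> orbit f s \<union> orbit f t"
  proof (rule orbit_subset_closed)
    have self: "s \<in> orbit f s" "t \<in> orbit f t"
      using permutation_self_in_orbit assms(1) by metis+
    show "?g z \<in> orbit f s \<union> orbit f t" if "z \<in> orbit f s \<union> orbit f t" for z
    proof -
      have "f z \<in> orbit f s \<union> orbit f t" using that orbit.step[of z f] by auto
      then show ?thesis using self by (auto simp: Transposition.transpose_def)
    qed
    then show "?g s \<in> orbit f s \<union> orbit f t" using self by blast
  qed
  ultimately show ?thesis by blast
qed

lemma orbit_transpose_comp_other:
  assumes "permutation f" "s \<notin> orbit f x" "t \<notin> orbit f x"
  shows "orbit (Transposition.transpose s t \<circ> f) x = orbit f x"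
proof (rule orbit_cong)
  show "x \<in> orbit f x" using assms(1) by (rule permutation_self_in_orbit)
  fix z assume "z \<in> orbit f x"
  then have "f z \<in> orbit f x" by (rule orbit.step)
  then have "f z \<noteq> s" "f z \<noteq> t" using assms by auto
  then show "(Transposition.transpose s t \<circ> f) z = f z" by simp
qed

text \<open>The orbits of \<open>s\<close> and \<open>t\<close> become one, and all others stay as
  they are.\<close>

lemma num_cycles_transpose_comp:
  assumes "f permutes X" "finite X" "s \<in> X" "t \<in> X" "t \<notin> orbit f s"
  shows "num_cycles X f = Suc (num_cycles X (Transposition.transpose s t \<circ> f))"
proof -
  let ?g = "Transposition.transpose s t \<circ> f"
  have f: "permutation f" using assms permutes_permutation by blast
  have g: "permutation ?g"
    by (intro permutation_compose permutation_swap_id f)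
  note selff = permutation_self_in_orbit[OF f] and selfg = permutation_self_in_orbit[OF g]
  note eqf = orbit_eqI_mem[OF f] and eqg = orbit_eqI_mem[OF g]
  define Y where "Y = X - (orbit f s \<union> orbit f t)"
  have X: "X = (orbit f s \<union> orbit f t) \<union> Y"
    using permutes_orbit_subset[OF assms(1)] assms(3,4) by (auto simp: Y_def)
  have s_nt: "s \<notin> orbit f t" using assms(5) eqf selff by metis
  have Yn: "s \<notin> orbit f x" "t \<notin> orbit f x" if "x \<in> Y" for x
    using that eqf selff by (auto simp: Y_def)
  have gs: "orbit ?g s = orbit f s \<union> orbit f t"
    by (rule orbit_transpose_comp[OF f assms(5)])
  have "orbit f ` X = insert (orbit f s) (insert (orbit f t) (orbit f ` Y))"
    (is "_ = insert ?a (insert ?b ?C)")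
  proof -
    have "orbit f ` orbit f x = {orbit f x}" for x using eqf selff by blast
    then show ?thesis by (subst X) (simp add: image_Un insert_commute)
  qed
  moreover have "orbit ?g ` X = insert (orbit f s \<union> orbit f t) (orbit f ` Y)"
  proof -
    have "orbit ?g ` X = orbit ?g ` (orbit ?g s) \<union> orbit ?g ` Y"
      by (subst X, subst gs) (simp add: image_Un)
    also have "orbit ?g ` (orbit ?g s) = {orbit ?g s}" using eqg selfg by blast
    also have "orbit ?g ` Y = orbit f ` Y"
      using orbit_transpose_comp_other[OF f Yn] by (intro image_cong) auto
    finally show ?thesis using gs unfolding comp_def by simp
  qed
  moreover have "?a \<notin> insert ?b ?C" "?b \<notin> ?C" "?a \<union> ?b \<notin> ?C"
    using Yn selff s_nt by blast+
  moreover have "finite ?C" using assms(2) Y_def by auto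
  ultimately show ?thesis by (simp add: num_cycles_def)
qed

section \<open>Cycle counts on disjoint sets, rising factorials and signs\<close>

lemma num_cycles_cong:
  assumes "f permutes S" "\<And>x. x \<in> S \<Longrightarrow> g x = f x"
  shows "num_cycles S g = num_cycles S f"
proof -
  have "orbit g x = orbit f x" if "x \<in> S" for x
    by (rule orbit_cong0[OF that])
      (use assms permutes_in_image in \<open>fastforce+\<close>)
  then show ?thesis unfolding num_cycles_def by (metis (mono_tags, lifting) image_cong)
qed

lemma num_cycles_comp:
  assumes "f permutes S" "g permutes U" "S \<inter> U = {}" "finite S" "finite U"
  shows "num_cycles S (f \<circ> g) = num_cycles S f"
    and "num_cycles (S \<union> U) (f \<circ> g) = num_cycles S f + num_cycles U g"
proof -
  let ?h = "f \<circ> g"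
  show S: "num_cycles S ?h = num_cycles S f"
    by (rule num_cycles_cong[OF assms(1)]) (use assms(3) permutes_not_in[OF assms(2)] in \<open>simp add: disjoint_iff\<close>)
  have U: "num_cycles U ?h = num_cycles U g"
    by (rule num_cycles_cong[OF assms(2)])
      (use assms permutes_not_in[OF assms(1)] permutes_in_image[OF assms(2)] in auto)
  have h: "permutation ?h"
    using assms permutes_permutation permutation_compose by blast
  have cl: "?h y \<in> S" if "y \<in> S" for y
    using that assms(3) permutes_not_in[OF assms(2)] permutes_in_image[OF assms(1)]
    by (simp add: disjoint_iff)
  then have "orbit ?h x \<subseteq> S" if "x \<in> S" for x
    by (intro orbit_subset_closed) (use that in auto)
  moreover have "x \<in> orbit ?h x" for x by (rule permutation_self_in_orbit[OF h])
  ultimately have "orbit ?h ` S \<inter> orbit ?h ` U = {}" using assms(3) by fast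
  then have "num_cycles (S \<union> U) ?h = num_cycles S ?h + num_cycles U ?h"
    unfolding num_cycles_def using assms by (simp add: image_Un card_Un_disjoint)
  then show "num_cycles (S \<union> U) ?h = num_cycles S f + num_cycles U g"
    using S U by simp
qed

text \<open>The choice \<open>b = a\<close> makes \<open>a\<close> a new fixed point; any other
  \<open>b\<close> splices \<open>a\<close> into the cycle of \<open>b\<close>.\<close>

lemma num_cycles_insert:
  assumes "finite S" "a \<notin> S" "f permutes S" "b \<in> insert a S"
  shows "num_cycles (insert a S) (Transposition.transpose a b \<circ> f)
    = num_cycles S f + (if b = a then 1 else 0)"
proof -
  have "num_cycles (S \<union> {a}) (f \<circ> id) = num_cycles S f + num_cycles {a} id"
    by (rule num_cycles_comp) (use assms in auto)
  moreover have "num_cycles {a} id = 1" by (simp add: num_cycles_def)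
  ultimately have *: "num_cycles (insert a S) f = Suc (num_cycles S f)" by simp
  show ?thesis
  proof (cases "b = a")
    case False
    have f: "f permutes insert a S" using assms(3) by (rule permutes_subset) auto
    have "orbit f a = {a}" using assms permutes_not_in orbit_eq_singleton_iff by metis
    then have "num_cycles (insert a S) f = Suc (num_cycles (insert a S) (Transposition.transpose a b \<circ> f))"
      using False assms by (intro num_cycles_transpose_comp[OF f]) auto
    then show ?thesis using False * by simp
  qed (use * in simp)
qed

text \<open>Points are inserted one at a time: the new point either opens a cycle, with factor
  \<open>z\<close>, or enters an existing one in \<open>card S\<close> ways. This builds up the
  rising factorial \<open>pochhammer\<close>.\<close>

lemma sum_permutes_power_num_cycles:
  fixes z :: "'b :: comm_ring_1"
  assumes "finite S"
  shows "(\<Sum>p | p permutes S. z ^ num_cycles S p) = pochhammer z (card S)"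
  using assms
proof induction
  case empty
  then show ?case by (simp add: num_cycles_def)
next
  case (insert a S)
  have "(\<Sum>p | p permutes insert a S. z ^ num_cycles (insert a S) p)
    = (\<Sum>b\<in>insert a S. \<Sum>q | q permutes S. z ^ num_cycles (insert a S) (Transposition.transpose a b \<circ> q))"
    by (rule sum_over_permutations_insert[OF insert(1,2)])
  also have "\<dots> = (\<Sum>b\<in>insert a S. \<Sum>q | q permutes S. z ^ (num_cycles S q + (if b = a then 1 else 0)))"
    by (intro sum.cong refl) (simp only: mem_Collect_eq num_cycles_insert[OF insert(1,2)])
  also have "\<dots> = (\<Sum>b\<in>insert a S. (if b = a then z else 1) * pochhammer z (card S))"
    by (intro sum.cong refl) (simp flip: insert.IH add: sum_distrib_left)
  also have "\<dots> = (z + of_nat (card S)) * pochhammer z (card S)"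
  proof -
    have "(\<Sum>b\<in>S. (if b = a then z else 1) * pochhammer z (card S)) = (\<Sum>b\<in>S. pochhammer z (card S))"
      by (intro sum.cong refl) (use insert(2) in auto)
    then show ?thesis using insert(1,2) by (simp add: algebra_simps)
  qed
  finally show ?case using insert(1,2) by (simp add: pochhammer_Suc mult.commute)
qed

text \<open>A new fixed point raises both the size and the cycle count; splicing a point into a
  cycle raises only the size and contributes a transposition.\<close>

lemma sign_eq_num_cycles:
  assumes "finite S" "p permutes S"
  shows "sign p = (-1) ^ (card S + num_cycles S p)"
  using assms
proof (induction S arbitrary: p)
  case empty
  then show ?case by (simp add: num_cycles_def)
next
  case (insert a S)
  obtain b q where q: "p = Transposition.transpose a b \<circ> q" "b \<in> insert a S" "q permutes S"
    using insert.prems permutes_insert[of a S] by fast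
  have "sign p = sign (Transposition.transpose a b) * sign q"
    unfolding q(1)
    by (intro sign_compose permutation_swap_id permutes_permutation[OF q(3) insert(1)])
  then show ?case
    using num_cycles_insert[OF insert(1,2) q(3,2), folded q(1)] insert.IH[OF q(3)] insert(1,2)
    by (cases "a = b") (simp_all add: sign_swap_id)
qed

section \<open>Invariant subsets\<close>

lemma closed_imp_invariant:
  assumes "f permutes X" "finite S" "\<And>x. x \<in> S \<Longrightarrow> f x \<in> S"
  shows "f ` S = S"
  using assms permutes_inj_on endo_inj_surj by (metis image_subsetI)

lemma Union_orbits_invariant:
  assumes "permutation f" "f ` S = S"
  shows "\<Union> (orbit f ` S) = S"
proof -
  have "orbit f x \<subseteq> S" if "x \<in> S" for x
    using assms(2) that by (intro orbit_subset_closed) auto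
  then show ?thesis using permutation_self_in_orbit[OF assms(1)] by blast
qed

lemma image_orbit_Union:
  assumes "permutation f" "A \<subseteq> orbit f ` Y"
  shows "orbit f ` (\<Union> A) = A"
proof -
  have "orbit f ` C = {C}" if C: "C \<in> A" for C
  proof -
    obtain y where y: "C = orbit f y" using C assms(2) by blast
    show ?thesis
      using orbit_eqI_mem[OF assms(1)] permutation_self_in_orbit[OF assms(1)] unfolding y by blast
  qed
  then have "orbit f ` (\<Union> A) = (\<Union>C\<in>A. {C})" by (simp add: image_Union)
  then show ?thesis by simp
qed

text \<open>Invariant subsets are exactly the unions of orbits, and the orbits can be read off from
  the union.\<close>

lemma bij_betw_invariant_subsets:
  assumes "f permutes X" "finite X" "Y \<subseteq> X" "f ` Y = Y"
  shows "bij_betw Union (Pow (orbit f ` Y)) {S. S \<subseteq> Y \<and> f ` S = S}"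
proof (rule bij_betw_byWitness[where f' = "image (orbit f)"])
  have f: "permutation f" using assms permutes_permutation by blast
  show "\<forall>A\<in>Pow (orbit f ` Y). orbit f ` \<Union> A = A"
    using image_orbit_Union[OF f] by blast
  show "\<forall>S\<in>{S. S \<subseteq> Y \<and> f ` S = S}. \<Union> (orbit f ` S) = S"
    using Union_orbits_invariant[OF f] by blast
  show "Union ` Pow (orbit f ` Y) \<subseteq> {S. S \<subseteq> Y \<and> f ` S = S}"
  proof clarify
    fix A assume A: "A \<subseteq> orbit f ` Y"
    then have sub: "\<Union> A \<subseteq> Y" using Union_orbits_invariant[OF f assms(4)] by blast
    moreover have "f ` \<Union> A = \<Union> A"
    proof (rule closed_imp_invariant[OF assms(1)])
      show "finite (\<Union> A)" by (rule finite_subset[OF order_trans[OF sub assms(3)] assms(2)])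
      show "f x \<in> \<Union> A" if x: "x \<in> \<Union> A" for x
      proof -
        obtain C where C: "C \<in> A" "x \<in> C" using x by blast
        then obtain z where "C = orbit f z" using A by blast
        then have "f x \<in> C" using C(2) orbit.step by simp
        then show ?thesis using C(1) by blast
      qed
    qed
    ultimately show "\<Union> A \<subseteq> Y \<and> f ` \<Union> A = \<Union> A" by blast
  qed
  show "image (orbit f) ` {S. S \<subseteq> Y \<and> f ` S = S} \<subseteq> Pow (orbit f ` Y)" by blast
qed

lemma card_Union_orbits:
  assumes "permutation f" "A \<subseteq> orbit f ` Y"
  shows "card (\<Union> A) = (\<Sum>C\<in>A. card C)"
proof (rule card_Union_disjoint)
  show "pairwise disjnt A"
    using assms orbit_eqI_mem[OF assms(1)] unfolding pairwise_def disjnt_def by blast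
  show "finite C" if "C \<in> A" for C
    using that assms(2) finite_orbit[OF permutation_self_in_orbit[OF assms(1)]] by blast
qed

section \<open>Alternating sums over a power set\<close>

lemma sum_Pow_insert:
  assumes "finite A" "a \<notin> A"
  shows "sum h (Pow (insert a A)) = sum h (Pow A) + (\<Sum>B\<in>Pow A. h (insert a B))"
proof -
  have "inj_on (insert a) (Pow A)"
    using assms(2) by (intro inj_onI) (metis PowD insert_ident subsetD)
  then have "sum h (insert a ` Pow A) = (\<Sum>B\<in>Pow A. h (insert a B))"
    by (simp add: sum.reindex)
  moreover have "sum h (Pow A \<union> insert a ` Pow A) = sum h (Pow A) + sum h (insert a ` Pow A)"
    by (rule sum.union_disjoint) (use assms in auto)
  ultimately show ?thesis by (simp add: Pow_insert)
qed

lemma sum_Pow_alternating: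
  assumes "finite A"
  shows "(\<Sum>B\<in>Pow A. (-1 :: 'a :: comm_ring_1) ^ card B) = (if A = {} then 1 else 0)"
  using assms
proof induction
  case (insert a A)
  have "(\<Sum>B\<in>Pow (insert a A). (-1 :: 'a) ^ card B)
    = (\<Sum>B\<in>Pow A. (-1) ^ card B) + (\<Sum>B\<in>Pow A. (-1) ^ card (insert a B))"
    by (rule sum_Pow_insert[OF insert(1,2)])
  also have "(\<Sum>B\<in>Pow A. (-1 :: 'a) ^ card (insert a B)) = (\<Sum>B\<in>Pow A. - ((-1) ^ card B))"
  proof (rule sum.cong)
    fix B assume "B \<in> Pow A"
    then have "finite B" "a \<notin> B" using insert finite_subset by auto
    then show "(-1 :: 'a) ^ card (insert a B) = - ((-1) ^ card B)" by simp
  qed simp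
  finally show ?case by (simp add: sum_negf)
qed simp

text \<open>Pairing \<open>B\<close> with \<open>insert a B\<close> leaves \<open>- g a\<close>
  times the unweighted alternating sum over the subsets of \<open>A'\<close>, which vanishes unless
  \<open>A'\<close> is empty.\<close>

lemma sum_Pow_alternating_weighted:
  fixes g :: "'b \<Rightarrow> 'a :: comm_ring_1"
  assumes "finite A"
  shows "(\<Sum>B\<in>Pow A. (-1) ^ card B * (\<Sum>C\<in>B. g C)) = (if card A = 1 then - (\<Sum>C\<in>A. g C) else 0)"
proof (cases "A = {}")
  case False
  then obtain a A' where A: "A = insert a A'" "a \<notin> A'" "finite A'"
    using assms by (metis all_not_in_conv finite_insert mk_disjoint_insert)
  have "(\<Sum>B\<in>Pow A. (-1) ^ card B * (\<Sum>C\<in>B. g C))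
    = (\<Sum>B\<in>Pow A'. (-1) ^ card B * (\<Sum>C\<in>B. g C))
      + (\<Sum>B\<in>Pow A'. (-1) ^ card (insert a B) * (\<Sum>C\<in>insert a B. g C))"
    unfolding A(1) by (rule sum_Pow_insert[OF A(3,2)])
  also have "(\<Sum>B\<in>Pow A'. (-1) ^ card (insert a B) * (\<Sum>C\<in>insert a B. g C))
    = (\<Sum>B\<in>Pow A'. - ((-1) ^ card B * (\<Sum>C\<in>B. g C)) - g a * (-1) ^ card B)"
  proof (rule sum.cong)
    fix B assume "B \<in> Pow A'"
    then have "finite B" "a \<notin> B" using A finite_subset by auto
    then show "(-1) ^ card (insert a B) * (\<Sum>C\<in>insert a B. g C)
      = - ((-1) ^ card B * (\<Sum>C\<in>B. g C)) - g a * (-1) ^ card B"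
      by (simp add: algebra_simps)
  qed simp
  finally have "(\<Sum>B\<in>Pow A. (-1) ^ card B * (\<Sum>C\<in>B. g C)) = - (g a * (\<Sum>B\<in>Pow A'. (-1) ^ card B))"
    by (simp add: sum_negf sum_subtractf sum_distrib_left)
  then show ?thesis using A by (auto simp: sum_Pow_alternating card_insert_if)
qed simp

text \<open>Seen as a set of orbits, \<open>S\<close> has \<open>num_cycles S f\<close> elements,
  and \<open>card S\<close> is additive over them. The weighted alternating sum therefore singles
  out the permutations with exactly one orbit; it serves as an indicator of full cycles.\<close>

lemma sum_invariant_subsets_alternating:
  assumes "f permutes X" "finite X" "X \<noteq> {}"
  shows "(\<Sum>S | S \<subseteq> X \<and> f ` S = S. (-1) ^ num_cycles S f * real (card S))
    = (if cyclic_on f X then - real (card X) else 0)"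
proof -
  have f: "permutation f" using assms permutes_permutation by blast
  have fX: "f ` X = X" using assms(1) permutes_image by blast
  let ?O = "orbit f ` X"
  have "(\<Sum>S | S \<subseteq> X \<and> f ` S = S. (-1) ^ num_cycles S f * real (card S))
    = (\<Sum>A\<in>Pow ?O. (-1) ^ num_cycles (\<Union> A) f * real (card (\<Union> A)))"
    by (rule sum.reindex_bij_betw[OF bij_betw_invariant_subsets[OF assms(1,2) subset_refl fX], symmetric])
  also have "\<dots> = (\<Sum>A\<in>Pow ?O. (-1) ^ card A * (\<Sum>C\<in>A. real (card C)))"
    by (intro sum.cong refl)
      (simp add: num_cycles_def image_orbit_Union[OF f] card_Union_orbits[OF f])
  also have "\<dots> = (if card ?O = 1 then - (\<Sum>C\<in>?O. real (card C)) else 0)"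
    by (rule sum_Pow_alternating_weighted) (use assms in simp)
  also have "(\<Sum>C\<in>?O. real (card C)) = real (card X)"
    using card_Union_orbits[OF f subset_refl, of X] Union_orbits_invariant[OF f fX] by simp
  also have "card ?O = 1 \<longleftrightarrow> cyclic_on f X"
  proof
    assume "card ?O = 1"
    then obtain C where C: "?O = {C}" using card_1_singletonE by blast
    then have "X = C" using Union_orbits_invariant[OF f fX] by simp
    then show "cyclic_on f X" using C assms(3) by (auto simp: cyclic_on_def)
  next
    assume "cyclic_on f X"
    then have "?O = {X}" using assms(3) orbit_cyclic_eq3 by fast
    then show "card ?O = 1" by simp
  qed
  finally show ?thesis .
qed

section \<open>Counting the subsets invariant under an involution\<close>

lemma sum_Pow_card:
  fixes g :: "nat \<Rightarrow> real"
  assumes "finite A"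
  shows "(\<Sum>B\<in>Pow A. g (card B)) = (\<Sum>j\<le>card A. real (card A choose j) * g j)"
proof -
  have "(\<Sum>B\<in>Pow A. g (card B)) = (\<Sum>j\<in>{..card A}. \<Sum>B | B \<in> Pow A \<and> card B = j. g (card B))"
    by (rule sum.group[symmetric]) (use assms card_mono in auto)
  also have "\<dots> = (\<Sum>j\<le>card A. real (card A choose j) * g j)"
    by (intro sum.cong refl) (use assms n_subsets in auto)
  finally show ?thesis .
qed

text \<open>Every orbit is a pair \<open>{i, a i}\<close>.\<close>

lemma fpf_involution_orbits:
  assumes "a \<in> fpf_involutions X" "finite X" "Y \<subseteq> X" "a ` Y = Y"
  shows "card Y = 2 * num_cycles Y a"
proof -
  have a: "permutation a" using assms permutes_permutation by (auto simp: fpf_involutions_def)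
  have "card C = 2" if C: "C \<in> orbit a ` Y" for C
  proof -
    obtain i where i: "i \<in> X" "C = orbit a i" using C assms(3) by auto
    have "orbit a i = {i, a i}"
    proof
      show "orbit a i \<subseteq> {i, a i}"
        by (rule orbit_subset_closed) (use assms(1) i(1) in \<open>auto simp: fpf_involutions_def\<close>)
      show "{i, a i} \<subseteq> orbit a i"
        using permutation_self_in_orbit[OF a] orbit.base by fast
    qed
    moreover have "a i \<noteq> i" using assms(1) i(1) by (auto simp: fpf_involutions_def)
    ultimately show ?thesis using i(2) by simp
  qed
  then have "card (\<Union> (orbit a ` Y)) = (\<Sum>C\<in>orbit a ` Y. 2)"
    using card_Union_orbits[OF a subset_refl, of Y] by simp
  then show ?thesis
    using Union_orbits_invariant[OF a assms(4)] by (simp add: num_cycles_def)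
qed

text \<open>An invariant subset amounts to a choice of \<open>j\<close> among the \<open>k\<close>
  pairs of partners in \<open>Y\<close>.\<close>

lemma sum_invariant_subsets_fpf_involution:
  fixes h :: "nat \<Rightarrow> real"
  assumes "a \<in> fpf_involutions X" "finite X" "Y \<subseteq> X" "a ` Y = Y" "card Y = 2 * k"
  shows "(\<Sum>S | S \<subseteq> Y \<and> a ` S = S. h (card S)) = (\<Sum>j\<le>k. real (k choose j) * h (2 * j))"
proof -
  have aX: "a permutes X" using assms by (auto simp: fpf_involutions_def)
  have a: "permutation a" using aX assms(2) permutes_permutation by blast
  let ?O = "orbit a ` Y"
  have k: "card ?O = k"
    using fpf_involution_orbits[OF assms(1-4)] assms(5) by (simp add: num_cycles_def)
  have bij: "bij_betw Union (Pow ?O) {S. S \<subseteq> Y \<and> a ` S = S}"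
    by (rule bij_betw_invariant_subsets[OF aX assms(2-4)])
  have "(\<Sum>S | S \<subseteq> Y \<and> a ` S = S. h (card S)) = (\<Sum>A\<in>Pow ?O. h (card (\<Union> A)))"
    by (rule sum.reindex_bij_betw[OF bij, symmetric])
  also have "\<dots> = (\<Sum>A\<in>Pow ?O. h (2 * card A))"
  proof (intro sum.cong refl arg_cong[where f = h])
    fix A assume A: "A \<in> Pow ?O"
    then have "\<Union> A \<in> {S. S \<subseteq> Y \<and> a ` S = S}" using bij_betwE[OF bij] by simp
    then have S: "\<Union> A \<subseteq> Y" "a ` \<Union> A = \<Union> A" by simp_all
    have "card (\<Union> A) = 2 * num_cycles (\<Union> A) a"
      by (rule fpf_involution_orbits[OF assms(1,2)]) (use S assms(3) in auto)
    then show "card (\<Union> A) = 2 * card A"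
      using image_orbit_Union[OF a] A by (simp add: num_cycles_def)
  qed
  also have "\<dots> = (\<Sum>j\<le>k. real (k choose j) * h (2 * j))"
    using sum_Pow_card[of ?O "\<lambda>j. h (2 * j)"] k assms(2,3) finite_subset by (metis finite_imageI)
  finally show ?thesis .
qed

section \<open>Signed sums over set stabilizers\<close>

lemma disjoint_permutes_commute:
  assumes "p permutes S" "q permutes U" "S \<inter> U = {}"
  shows "p \<circ> q = q \<circ> p"
proof
  fix x
  show "(p \<circ> q) x = (q \<circ> p) x"
    using assms permutes_not_in[OF assms(1)] permutes_not_in[OF assms(2)]
      permutes_in_image[OF assms(1)] permutes_in_image[OF assms(2)]
    unfolding o_apply disjoint_iff by metis
qed

text \<open>As \<open>t\<close> is its own inverse, \<open>t \<circ> g \<circ> t\<close> is a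
  conjugate of \<open>g\<close>, and \<open>t\<close> carries the orbits of \<open>g\<close>
  bijectively to those of the conjugate.\<close>

lemma num_cycles_conj:
  assumes "t permutes X" "g permutes X" "finite X" "t \<circ> t = id"
  shows "num_cycles X (t \<circ> g \<circ> t) = num_cycles X g"
proof -
  have tt: "t (t x) = x" for x using assms(4) by (metis comp_apply id_apply)
  have "t ` orbit g x = orbit (t \<circ> g \<circ> t) (t x)" for x
    by (rule orbit_inverse[OF permutation_self_in_orbit[OF permutes_permutation[OF assms(2,3)]]])
      (simp add: tt)
  then have "image t ` (orbit g ` X) = orbit (t \<circ> g \<circ> t) ` (t ` X)"
    by (simp only: image_image)
  then have "orbit (t \<circ> g \<circ> t) ` X = image t ` (orbit g ` X)"
    using permutes_image[OF assms(1)] by simp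
  moreover have "inj_on (image t) (orbit g ` X)"
    by (rule inj_onI) (simp add: inj_image_eq_iff[OF permutes_inj[OF assms(1)]])
  ultimately show ?thesis unfolding num_cycles_def by (metis card_image)
qed

lemma restrict_id_permutes:
  assumes "f permutes X" "f ` S = S"
  shows "restrict_id f S permutes S"
  using assms permutes_inj_on permutes_restrict_id by (metis bij_betw_def)

text \<open>The stabilizer of \<open>S\<close> is the product of the symmetric groups of
  \<open>S\<close> and \<open>X - S\<close>; the two factors are recovered from \<open>b\<close> by
  restriction.\<close>

lemma sum_permutes_stabilizer:
  assumes "S \<subseteq> X"
  shows "(\<Sum>b | b permutes X \<and> b ` S = S. h b)
    = (\<Sum>p | p permutes S. \<Sum>q | q permutes X - S. h (p \<circ> q))"
proof -
  have inv: "b ` (X - S) = X - S" if "b permutes X" "b ` S = S" for b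
    using that permutes_image[OF that(1)] permutes_inj[OF that(1)] by (simp add: image_set_diff)
  have restr: "restrict_id (p \<circ> q) S = p" "restrict_id (p \<circ> q) (X - S) = q"
    if p: "p permutes S" and q: "q permutes X - S" for p q
  proof -
    show "restrict_id (p \<circ> q) S = p"
      using permutes_not_in[OF p] permutes_not_in[OF q] by (auto simp: restrict_id_def)
    show "restrict_id (p \<circ> q) (X - S) = q"
    proof
      show "restrict_id (p \<circ> q) (X - S) x = q x" for x
        using permutes_not_in[OF p] permutes_not_in[OF q] permutes_in_image[OF q, of x]
        by (auto simp: restrict_id_def)
    qed
  qed
  have decomp: "restrict_id b S \<circ> restrict_id b (X - S) = b" if b: "b permutes X" "b ` S = S" for b
  proof
    fix x
    consider "x \<in> S" | "x \<in> X - S" | "x \<notin> X" by blast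
    then show "(restrict_id b S \<circ> restrict_id b (X - S)) x = b x"
    proof cases
      case 2
      then have "b x \<in> X - S" using inv[OF b] by blast
      then show ?thesis using 2 by (simp add: restrict_id_def)
    next
      case 3
      then show ?thesis using permutes_not_in[OF b(1)] assms by (auto simp: restrict_id_def)
    qed (simp add: restrict_id_def)
  qed
  have comp: "p \<circ> q permutes X" "(p \<circ> q) ` S = S"
    if p: "p permutes S" and q: "q permutes X - S" for p q
  proof -
    have "p permutes X" "q permutes X"
      using assms permutes_subset[OF p] permutes_subset[OF q] by auto
    then show "p \<circ> q permutes X" using permutes_compose by blast
    have "(p \<circ> q) ` S = p ` S"
      using permutes_not_in[OF q] by (intro image_cong) auto
    then show "(p \<circ> q) ` S = S" using permutes_image[OF p] by simp
  qed
  have perm: "restrict_id b S permutes S" "restrict_id b (X - S) permutes X - S"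
    if b: "b permutes X" "b ` S = S" for b
    using restrict_id_permutes b inv[OF b] by blast+
  have "bij_betw (\<lambda>(p, q). p \<circ> q) ({p. p permutes S} \<times> {q. q permutes X - S})
    {b. b permutes X \<and> b ` S = S}"
    by (rule bij_betw_byWitness[where f' = "\<lambda>b. (restrict_id b S, restrict_id b (X - S))"];
        clarify; simp only: prod.case mem_Collect_eq mem_Sigma_iff restr decomp comp perm)
  from sum.reindex_bij_betw[OF this, of h]
  show ?thesis by (simp add: sum.cartesian_product case_prod_unfold)
qed

text \<open>The contribution of \<open>S\<close> to the sum over full cycles, up to sign and the
  weight \<open>card S\<close>: here \<open>p \<circ> q\<close> runs through the stabilizer of
  \<open>S\<close>.\<close>

definition split_sum :: "real \<Rightarrow> 'a set \<Rightarrow> ('a \<Rightarrow> 'a) \<Rightarrow> 'a set \<Rightarrow> real" where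
  "split_sum y X a S = (\<Sum>p | p permutes S. \<Sum>q | q permutes X - S.
     (-1) ^ num_cycles S p * y ^ num_cycles X (a \<circ> (p \<circ> q)))"

text \<open>The parity of the cycle count differs from the sign only by the constant factor
  \<open>(-1) ^ card S\<close>, and the sign is multiplicative.\<close>

lemma minus_one_power_num_cycles_comp:
  assumes "finite S" "r permutes S" "p permutes S"
  shows "(-1 :: real) ^ num_cycles S (r \<circ> p) = of_int (sign r) * (-1) ^ num_cycles S p"
proof -
  have "permutation r" "permutation p" using assms permutes_permutation by blast+
  then have "sign (r \<circ> p) = sign r * sign p" by (rule sign_compose)
  moreover have "r \<circ> p permutes S" using assms permutes_compose by blast
  ultimately have "(-1 :: int) ^ (card S + num_cycles S (r \<circ> p)) = sign r * (-1) ^ (card S + num_cycles S p)"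
    using sign_eq_num_cycles assms by metis
  then have "(-1 :: int) ^ card S * ((-1) ^ card S * (-1) ^ num_cycles S (r \<circ> p))
    = (-1) ^ card S * ((-1) ^ card S * (sign r * (-1) ^ num_cycles S p))"
    by (simp add: power_add algebra_simps)
  then have "(-1 :: int) ^ num_cycles S (r \<circ> p) = sign r * (-1) ^ num_cycles S p"
    by simp
  then have "real_of_int ((-1) ^ num_cycles S (r \<circ> p)) = real_of_int (sign r * (-1) ^ num_cycles S p)"
    by simp
  then show ?thesis by simp
qed

text \<open>Conjugating \<open>a \<circ> b\<close> by the transposition of \<open>a s\<close> and \<open>a s'\<close> keeps its number of
  cycles but flips the sign of the restriction of \<open>b\<close> to \<open>S\<close>.\<close>

lemma split_sum_eq_0:
  assumes "finite X" "S \<subseteq> X" "a permutes X" "s \<in> S" "s' \<in> S" "s \<noteq> s'" "a s \<notin> S" "a s' \<notin> S"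
  shows "split_sum y X a S = 0"
proof -
  define \<sigma> \<tau> where "\<sigma> = Transposition.transpose s s'" and "\<tau> = Transposition.transpose (a s) (a s')"
  have \<sigma>: "\<sigma> permutes S" unfolding \<sigma>_def by (rule permutes_swap_id[OF assms(4,5)])
  have "a s \<in> X" "a s' \<in> X" using assms permutes_in_image[OF assms(3)] by auto
  then have \<tau>: "\<tau> permutes X - S" unfolding \<tau>_def by (intro permutes_swap_id) (use assms in auto)
  then have \<tau>X: "\<tau> permutes X" by (rule permutes_subset) auto
  \<comment> \<open>Exchanging \<open>s\<close> and \<open>s'\<close> before applying
    \<open>a\<close> exchanges their images afterwards. Hence conjugation by \<open>\<tau>\<close>
    amounts to multiplying \<open>p\<close> by \<open>\<sigma>\<close> on the left and
    \<open>q\<close> by \<open>\<tau>\<close> on the right.\<close>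
  have a\<sigma>: "a \<circ> \<sigma> = \<tau> \<circ> a"
    using permutes_inj[OF assms(3)] unfolding \<sigma>_def \<tau>_def
    by (auto simp: Transposition.transpose_def inj_eq)
  have fS: "finite S" using assms finite_subset by blast
  have sg: "sign \<sigma> = -1" using assms by (simp add: \<sigma>_def sign_swap_id)
  have cyc: "num_cycles X (a \<circ> (\<sigma> \<circ> p \<circ> (q \<circ> \<tau>))) = num_cycles X (a \<circ> (p \<circ> q))"
    if "p permutes S" "q permutes X - S" for p q
  proof -
    have "p permutes X" "q permutes X"
      using assms permutes_subset[OF that(1)] permutes_subset[OF that(2)] by auto
    then have "a \<circ> (p \<circ> q) permutes X" using assms(3) permutes_compose by blast
    moreover have "\<tau> \<circ> \<tau> = id" by (simp add: \<tau>_def)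
    ultimately have "num_cycles X (\<tau> \<circ> (a \<circ> (p \<circ> q)) \<circ> \<tau>) = num_cycles X (a \<circ> (p \<circ> q))"
      using num_cycles_conj[OF \<tau>X] assms(1) by blast
    moreover have "a \<circ> (\<sigma> \<circ> p \<circ> (q \<circ> \<tau>)) = (a \<circ> \<sigma>) \<circ> (p \<circ> q) \<circ> \<tau>" by (simp only: o_assoc)
    ultimately show ?thesis using a\<sigma> by (simp only: o_assoc)
  qed
  \<comment> \<open>Reindexing \<open>p\<close> and \<open>q\<close> keeps the sum but negates each
    summand, so the sum equals its own negative.\<close>
  have "split_sum y X a S = (\<Sum>p | p permutes S. \<Sum>q | q permutes X - S.
     (-1) ^ num_cycles S (\<sigma> \<circ> p) * y ^ num_cycles X (a \<circ> (\<sigma> \<circ> p \<circ> (q \<circ> \<tau>))))"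
    unfolding split_sum_def
    by (subst setum_permutations_compose_left[OF \<sigma>], subst sum_permutations_compose_right[OF \<tau>]) simp
  also have "\<dots> = (\<Sum>p | p permutes S. \<Sum>q | q permutes X - S.
     - ((-1) ^ num_cycles S p * y ^ num_cycles X (a \<circ> (p \<circ> q))))"
  proof (intro sum.cong refl)
    fix p q assume "p \<in> {p. p permutes S}" "q \<in> {q. q permutes X - S}"
    then show "(-1) ^ num_cycles S (\<sigma> \<circ> p) * y ^ num_cycles X (a \<circ> (\<sigma> \<circ> p \<circ> (q \<circ> \<tau>)))
      = - ((-1) ^ num_cycles S p * y ^ num_cycles X (a \<circ> (p \<circ> q)))"
      using cyc[of p q] minus_one_power_num_cycles_comp[OF fS \<sigma>, of p] sg by simp
  qed
  also have "\<dots> = - split_sum y X a S" unfolding split_sum_def by (simp add: sum_negf)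
  finally show ?thesis by simp
qed

text \<open>Common form of the two surviving cases. Reindexing by \<open>a1 \<circ> p\<close> and
  \<open>a2 \<circ> q\<close> costs \<open>sign a1\<close> and leaves only \<open>\<rho>\<close>;
  then the exponent splits and the double sum factors. The number \<open>e\<close> counts the cycles
  lost through \<open>\<rho>\<close>; the factor \<open>y ^ e\<close> stands on the left because
  \<open>y\<close> may be zero.\<close>

lemma split_sum_factor:
  assumes "finite X" "S \<subseteq> X" "a = \<rho> \<circ> (a1 \<circ> a2)" "a1 permutes S" "a2 permutes X - S"
    and cyc: "\<And>p q. p permutes S \<Longrightarrow> q permutes X - S \<Longrightarrow>
      num_cycles X (\<rho> \<circ> (p \<circ> q)) + e = num_cycles S p + num_cycles (X - S) q"
  shows "y ^ e * split_sum y X a S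
    = of_int (sign a1) * (pochhammer (- y) (card S) * pochhammer y (card X - card S))"
proof -
  have fS: "finite S" using assms finite_subset by blast
  define G where "G p q = of_int (sign a1) * (-1) ^ num_cycles S p * y ^ num_cycles X (\<rho> \<circ> (p \<circ> q))" for p q
  have "split_sum y X a S = (\<Sum>p | p permutes S. \<Sum>q | q permutes X - S. G (a1 \<circ> p) (a2 \<circ> q))"
    unfolding split_sum_def
  proof (intro sum.cong refl)
    fix p q assume "p \<in> {p. p permutes S}" "q \<in> {q. q permutes X - S}"
    then have p: "p permutes S" and q: "q permutes X - S" by auto
    \<comment> \<open>Disjoint supports let \<open>a2\<close> move past \<open>p\<close>, so that it
      meets \<open>q\<close>.\<close>
    have "a2 \<circ> p = p \<circ> a2" using disjoint_permutes_commute[OF p assms(5)] by auto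
    then have "a \<circ> (p \<circ> q) = \<rho> \<circ> ((a1 \<circ> p) \<circ> (a2 \<circ> q))"
      unfolding assms(3) by (metis o_assoc)
    moreover have "(-1 :: real) ^ num_cycles S p = of_int (sign a1) * (-1) ^ num_cycles S (a1 \<circ> p)"
      using minus_one_power_num_cycles_comp[OF fS assms(4) p] 
      by (metis mult.assoc mult_1 of_int_1 of_int_mult sign_idempotent)
    ultimately show "(-1) ^ num_cycles S p * y ^ num_cycles X (a \<circ> (p \<circ> q)) = G (a1 \<circ> p) (a2 \<circ> q)"
      by (simp only: G_def)
  qed
  also have "\<dots> = (\<Sum>p | p permutes S. \<Sum>q | q permutes X - S. G p q)"
    by (subst setum_permutations_compose_left[OF assms(4), of "\<lambda>p. \<Sum>q | q permutes X - S. G p q"],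
        subst setum_permutations_compose_left[OF assms(5)]) simp
  finally have "y ^ e * split_sum y X a S = (\<Sum>p | p permutes S. \<Sum>q | q permutes X - S. y ^ e * G p q)"
    by (simp add: sum_distrib_left)
  also have "\<dots> = (\<Sum>p | p permutes S. \<Sum>q | q permutes X - S.
    of_int (sign a1) * ((- y) ^ num_cycles S p * y ^ num_cycles (X - S) q))"
  proof (intro sum.cong refl)
    fix p q assume "p \<in> {p. p permutes S}" "q \<in> {q. q permutes X - S}"
    then have "num_cycles X (\<rho> \<circ> (p \<circ> q)) + e = num_cycles S p + num_cycles (X - S) q"
      using cyc by simp
    then have "y ^ num_cycles X (\<rho> \<circ> (p \<circ> q)) * y ^ e = y ^ num_cycles S p * y ^ num_cycles (X - S) q"
      by (simp flip: power_add)
    moreover have "(- y) ^ num_cycles S p = (-1) ^ num_cycles S p * y ^ num_cycles S p"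
      by (rule power_minus)
    moreover have "y ^ e * G p q = of_int (sign a1) * ((-1) ^ num_cycles S p
      * (y ^ num_cycles X (\<rho> \<circ> (p \<circ> q)) * y ^ e))"
      unfolding G_def by (simp only: ac_simps)
    ultimately show "y ^ e * G p q
      = of_int (sign a1) * ((- y) ^ num_cycles S p * y ^ num_cycles (X - S) q)"
      by (simp only: mult.assoc)
  qed
  also have "\<dots> = of_int (sign a1) * ((\<Sum>p | p permutes S. (- y) ^ num_cycles S p)
    * (\<Sum>q | q permutes X - S. y ^ num_cycles (X - S) q))"
    by (subst sum_product) (simp only: sum_distrib_left)
  also have "\<dots> = of_int (sign a1) * (pochhammer (- y) (card S) * pochhammer y (card X - card S))"
    using assms fS by (simp add: sum_permutes_power_num_cycles card_Diff_subset)
  finally show ?thesis .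
qed

text \<open>The restriction has \<open>j\<close> cycles on \<open>2 * j\<close> points, which gives
  the exponent \<open>3 * j\<close>.\<close>

lemma sign_restrict_fpf_involution:
  assumes "a \<in> fpf_involutions X" "finite X" "P \<subseteq> X" "a ` P = P" "card P = 2 * j"
  shows "sign (restrict_id a P) = (-1) ^ j"
proof -
  have a: "a permutes X" using assms by (auto simp: fpf_involutions_def)
  have r: "restrict_id a P permutes P" by (rule restrict_id_permutes[OF a assms(4)])
  have fP: "finite P" using assms finite_subset by blast
  have "num_cycles P a = num_cycles P (restrict_id a P)"
    by (rule num_cycles_cong[OF r]) (simp add: restrict_id_def)
  moreover have "num_cycles P a = j" using fpf_involution_orbits[OF assms(1-4)] assms(5) by simp
  ultimately show ?thesis
    using sign_eq_num_cycles[OF fP r] unfolding assms(5) power_add power_mult by simp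
qed

text \<open>All partners lie on the same side, so \<open>a\<close> is the product of its
  restrictions to \<open>S\<close> and \<open>X - S\<close>, and no cycle is lost:
  \<open>\<rho>\<close> is the identity and \<open>e = 0\<close>.\<close>

lemma split_sum_invariant:
  assumes "a \<in> fpf_involutions X" "finite X" "S \<subseteq> X" "a ` S = S" "card S = 2 * j"
  shows "split_sum y X a S = (-1) ^ j * (pochhammer (- y) (card S) * pochhammer y (card X - card S))"
proof -
  have a: "a permutes X" using assms by (auto simp: fpf_involutions_def)
  have U: "a ` (X - S) = X - S"
    using assms(4) permutes_image[OF a] permutes_inj[OF a] by (simp add: image_set_diff)
  have fS: "finite S" using assms finite_subset by blast
  note r = restrict_id_permutes[OF a assms(4)] restrict_id_permutes[OF a U]
  have "y ^ 0 * split_sum y X a S = of_int (sign (restrict_id a S))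
    * (pochhammer (- y) (card S) * pochhammer y (card X - card S))"
  proof (rule split_sum_factor[OF assms(2,3) _ r, of _ id])
    show "a = id \<circ> (restrict_id a S \<circ> restrict_id a (X - S))"
    proof
      fix x
      show "a x = (id \<circ> (restrict_id a S \<circ> restrict_id a (X - S))) x"
        using U permutes_not_in[OF a] assms(3) by (auto simp: restrict_id_def)
    qed
    fix p q assume pq: "p permutes S" "q permutes X - S"
    have "num_cycles (S \<union> (X - S)) (p \<circ> q) = num_cycles S p + num_cycles (X - S) q"
      by (rule num_cycles_comp(2)[OF pq]) (use assms(2) fS in auto)
    then show "num_cycles X (id \<circ> (p \<circ> q)) + 0 = num_cycles S p + num_cycles (X - S) q"
      using assms(3) by (simp add: Un_absorb1)
  qed
  then show ?thesis by (simp add: sign_restrict_fpf_involution[OF assms])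
qed

text \<open>Here \<open>s\<close> is the only point of \<open>S\<close> with its partner outside.
  Apart from its restrictions to invariant sets, \<open>a\<close> consists of the transposition of
  \<open>s\<close> and \<open>a s\<close>, which joins a cycle of \<open>p\<close> to one of
  \<open>q\<close>; hence \<open>e = 1\<close>.\<close>

lemma split_sum_insert:
  assumes "a \<in> fpf_involutions X" "finite X" "s \<in> X" "P \<subseteq> X - {s, a s}" "a ` P = P" "card P = 2 * j"
  defines "S \<equiv> insert s P"
  shows "y * split_sum y X a S
    = (-1) ^ j * (pochhammer (- y) (2 * j + 1) * pochhammer y (card X - (2 * j + 1)))"
proof -
  have a: "a permutes X" and inv: "\<And>i. i \<in> X \<Longrightarrow> a (a i) = i" "\<And>i. i \<in> X \<Longrightarrow> a i \<noteq> i"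
    using assms by (auto simp: fpf_involutions_def)
  have PX: "P \<subseteq> X" and SX: "S \<subseteq> X" using assms by auto
  have fS: "finite S" using SX assms(2) finite_subset by blast
  have asX: "a s \<in> X" using assms(3) permutes_in_image[OF a] by blast
  have asS: "a s \<notin> S" using assms(3,4) inv(2) by (auto simp: S_def)
  have cS: "card S = 2 * j + 1" using fS assms(4,6) by (simp add: S_def card_insert_if subset_Diff_insert)
  define U where "U = X - {s, a s} - P"
  have "a ` {s, a s} = {s, a s}" using inv(1)[OF assms(3)] by auto
  then have U: "a ` U = U"
    using assms(5) permutes_image[OF a] permutes_inj[OF a] by (simp add: image_set_diff U_def)
  \<comment> \<open>The restrictions fix \<open>s\<close> and \<open>a s\<close>, so they may be
    regarded as permutations of the larger sets \<open>S\<close> and \<open>X - S\<close>.\<close>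
  have a1: "restrict_id a P permutes S"
    using restrict_id_permutes[OF a assms(5)] by (rule permutes_subset) (auto simp: S_def)
  have a2: "restrict_id a U permutes X - S"
    using restrict_id_permutes[OF a U] by (rule permutes_subset) (auto simp: S_def U_def)
  have "y ^ 1 * split_sum y X a S = of_int (sign (restrict_id a P))
    * (pochhammer (- y) (card S) * pochhammer y (card X - card S))"
  proof (rule split_sum_factor[OF assms(2) SX _ a1 a2, of _ "Transposition.transpose s (a s)"])
    show "a = Transposition.transpose s (a s) \<circ> (restrict_id a P \<circ> restrict_id a U)"
    proof
      fix x
      consider "x = s" | "x = a s" | "x \<in> P" | "x \<in> U" | "x \<notin> X" by (auto simp: U_def)
      then show "a x = (Transposition.transpose s (a s) \<circ> (restrict_id a P \<circ> restrict_id a U)) x"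
      proof cases
        case 1
        then show ?thesis using assms(4) by (auto simp: restrict_id_def U_def)
      next
        case 2
        then show ?thesis using assms(4) inv(1)[OF assms(3)] by (auto simp: restrict_id_def U_def)
      next
        case 3
        then have "a x \<in> P" using assms(5) by blast
        then have "a x \<noteq> s" "a x \<noteq> a s" using assms(4) by auto
        moreover have "x \<notin> U" using 3 by (simp add: U_def)
        ultimately show ?thesis using 3 by (simp add: restrict_id_def)
      next
        case 4
        then have "a x \<in> U" using U by blast
        then have "a x \<noteq> s" "a x \<noteq> a s" "a x \<notin> P" by (auto simp: U_def)
        then show ?thesis using 4 by (simp add: restrict_id_def)
      next
        case 5
        then have "x \<notin> U" "x \<notin> P" "x \<noteq> s" "x \<noteq> a s" using assms(3) PX asX by (auto simp: U_def)
        then show ?thesis using permutes_not_in[OF a 5] by (simp add: restrict_id_def)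
      qed
    qed
    fix p q assume pq: "p permutes S" "q permutes X - S"
    have "num_cycles (S \<union> (X - S)) (p \<circ> q) = num_cycles S p + num_cycles (X - S) q"
      by (rule num_cycles_comp(2)[OF pq]) (use assms(2) fS in auto)
    then have 1: "num_cycles X (p \<circ> q) = num_cycles S p + num_cycles (X - S) q"
      using SX by (simp add: Un_absorb1)
    have pqX: "p \<circ> q permutes X"
      using permutes_compose permutes_subset[OF pq(1) SX] permutes_subset[OF pq(2) Diff_subset] by blast
    \<comment> \<open>Since \<open>p \<circ> q\<close> preserves \<open>S\<close>, the orbit of
      \<open>s\<close> never reaches \<open>a s\<close>, and the transposition really merges two
      cycles.\<close>
    have clS: "(p \<circ> q) x \<in> S" if "x \<in> S" for x
      using that permutes_in_image[OF pq(1)] permutes_not_in[OF pq(2)] by simp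
    have sS: "s \<in> S" by (simp add: S_def)
    have "orbit (p \<circ> q) s \<subseteq> S"
      by (rule orbit_subset_closed) (use clS sS in blast)+
    then have "a s \<notin> orbit (p \<circ> q) s" using asS by blast
    from num_cycles_transpose_comp[OF pqX assms(2,3) asX this] 1
    show "num_cycles X (Transposition.transpose s (a s) \<circ> (p \<circ> q)) + 1
      = num_cycles S p + num_cycles (X - S) q" by simp
  qed
  then show ?thesis
    using cS by (simp add: sign_restrict_fpf_involution[OF assms(1,2) PX assms(5,6)])
qed

section \<open>Sums over full cycles\<close>

text \<open>The indicator of full cycles is replaced by the alternating sum over invariant
  \<open>S\<close>. Exchanging the summations makes \<open>b\<close> run through the stabilizer of
  \<open>S\<close>, which splits as a product.\<close>

lemma sum_full_cycles_conv_split_sum: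
  assumes "finite X" "X \<noteq> {}"
  shows "real (card X) * (\<Sum>b\<in>full_cycles X. y ^ num_cycles X (a \<circ> b))
    = - (\<Sum>S\<in>Pow X. real (card S) * split_sum y X a S)"
proof -
  let ?P = "{b. b permutes X}"
  let ?g = "\<lambda>b S. real (card S) * ((-1) ^ num_cycles S b * y ^ num_cycles X (a \<circ> b))"
  have finP: "finite ?P" using assms(1) by (rule finite_permutations)
  have fc: "full_cycles X = {b \<in> ?P. cyclic_on b X}" by (auto simp: full_cycles_def)
  have "real (card X) * (\<Sum>b\<in>full_cycles X. y ^ num_cycles X (a \<circ> b))
    = (\<Sum>b\<in>?P. if cyclic_on b X then real (card X) * y ^ num_cycles X (a \<circ> b) else 0)"
    unfolding fc sum.inter_filter[OF finP] sum_distrib_left by (intro sum.cong) auto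
  also have "\<dots> = (\<Sum>b\<in>?P. - (\<Sum>S | S \<in> Pow X \<and> b ` S = S. ?g b S))"
  proof (intro sum.cong refl)
    fix b assume b: "b \<in> ?P"
    have "(\<Sum>S | S \<in> Pow X \<and> b ` S = S. ?g b S)
      = (\<Sum>S | S \<subseteq> X \<and> b ` S = S. (-1) ^ num_cycles S b * real (card S)) * y ^ num_cycles X (a \<circ> b)"
      unfolding sum_distrib_right Pow_iff by (intro sum.cong refl) (simp only: ac_simps)
    then show "(if cyclic_on b X then real (card X) * y ^ num_cycles X (a \<circ> b) else 0)
      = - (\<Sum>S | S \<in> Pow X \<and> b ` S = S. ?g b S)"
      using sum_invariant_subsets_alternating[of b X] b assms by simp
  qed
  also have "\<dots> = - (\<Sum>S\<in>Pow X. \<Sum>b | b \<in> ?P \<and> b ` S = S. ?g b S)"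
    unfolding sum_negf by (subst sum.swap_restrict) (use finP assms(1) in auto)
  also have "(\<Sum>S\<in>Pow X. \<Sum>b | b \<in> ?P \<and> b ` S = S. ?g b S) = (\<Sum>S\<in>Pow X. real (card S) * split_sum y X a S)"
  proof (intro sum.cong refl)
    fix S assume S: "S \<in> Pow X"
    have "(\<Sum>b | b \<in> ?P \<and> b ` S = S. ?g b S)
      = (\<Sum>p | p permutes S. \<Sum>q | q permutes X - S. ?g (p \<circ> q) S)"
      unfolding mem_Collect_eq by (rule sum_permutes_stabilizer) (use S in auto)
    also have "\<dots> = (\<Sum>p | p permutes S. \<Sum>q | q permutes X - S.
      real (card S) * ((-1) ^ num_cycles S p * y ^ num_cycles X (a \<circ> (p \<circ> q))))"
    proof (intro sum.cong refl)
      fix p q assume "p \<in> {p. p permutes S}" "q \<in> {q. q permutes X - S}"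
      then have pq: "p permutes S" "q permutes X - S" by auto
      have fin: "finite S" "finite (X - S)" using S assms(1) finite_subset by auto
      show "?g (p \<circ> q) S = real (card S) * ((-1) ^ num_cycles S p * y ^ num_cycles X (a \<circ> (p \<circ> q)))"
        using num_cycles_comp(1)[OF pq _ fin] by auto
    qed
    finally show "(\<Sum>b | b \<in> ?P \<and> b ` S = S. ?g b S) = real (card S) * split_sum y X a S"
      by (simp only: split_sum_def sum_distrib_left)
  qed
  finally show ?thesis .
qed

text \<open>Subsets are classified by the set \<open>H S\<close> of their points whose partner is
  missing. If it is empty, \<open>S\<close> is invariant; if it is \<open>{s}\<close>, then
  \<open>S - {s}\<close> is invariant and avoids \<open>a s\<close>; otherwise \<open>h S\<close>
  vanishes.\<close>

lemma sum_Pow_fpf_involution: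
  fixes h :: "'a set \<Rightarrow> real"
  assumes "a \<in> fpf_involutions X" "finite X"
    and zero: "\<And>S s s'. S \<subseteq> X \<Longrightarrow> s \<in> S \<Longrightarrow> s' \<in> S \<Longrightarrow> s \<noteq> s' \<Longrightarrow> a s \<notin> S \<Longrightarrow> a s' \<notin> S \<Longrightarrow> h S = 0"
  shows "(\<Sum>S\<in>Pow X. h S) = (\<Sum>S | S \<subseteq> X \<and> a ` S = S. h S)
    + (\<Sum>s\<in>X. \<Sum>P | P \<subseteq> X - {s, a s} \<and> a ` P = P. h (insert s P))"
proof -
  have a: "a permutes X" and inv: "\<And>i. i \<in> X \<Longrightarrow> a (a i) = i" "\<And>i. i \<in> X \<Longrightarrow> a i \<noteq> i"
    using assms by (auto simp: fpf_involutions_def)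
  define H where "H S = {s \<in> S. a s \<notin> S}" for S
  define A where "A = {S. S \<subseteq> X \<and> a ` S = S}"
  define B where "B = {S. S \<subseteq> X \<and> (\<exists>s. H S = {s})}"
  have H_inv: "a ` S = S" if "S \<subseteq> X" "H S = {}" for S
    by (rule closed_imp_invariant[OF a])
      (use that assms(2) finite_subset in \<open>auto simp: H_def\<close>)
  have "(\<Sum>S\<in>Pow X. h S) = (\<Sum>S\<in>A \<union> B. h S)"
  proof (rule sum.mono_neutral_right)
    show "finite (Pow X)" using assms(2) by simp
    show "A \<union> B \<subseteq> Pow X" by (auto simp: A_def B_def)
    show "\<forall>S\<in>Pow X - (A \<union> B). h S = 0"
    proof
      fix S assume S: "S \<in> Pow X - (A \<union> B)"
      then have SX: "S \<subseteq> X" by auto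
      have "H S \<noteq> {}" using S H_inv by (auto simp: A_def)
      then obtain s where s: "s \<in> H S" by blast
      have "H S \<noteq> {s}" using S by (auto simp: B_def)
      then obtain s' where "s' \<in> H S" "s \<noteq> s'" using s by blast
      then show "h S = 0" using s zero[OF SX, of s s'] by (auto simp: H_def)
    qed
  qed
  also have "\<dots> = (\<Sum>S\<in>A. h S) + (\<Sum>S\<in>B. h S)"
  proof (rule sum.union_disjoint)
    show "finite A" "finite B" using assms(2) by (simp_all add: A_def B_def)
    have "H S = {}" if "S \<in> A" for S using that by (auto simp: A_def H_def)
    then show "A \<inter> B = {}" by (auto simp: B_def)
  qed
  also have "(\<Sum>S\<in>B. h S) = (\<Sum>(s, P)\<in>Sigma X (\<lambda>s. {P. P \<subseteq> X - {s, a s} \<and> a ` P = P}). h (insert s P))"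
    (is "_ = sum _ ?Z")
  proof -
    have H_insert: "H (insert s P) = {s}" if "s \<in> X" "P \<subseteq> X - {s, a s}" "a ` P = P" for s P
      using that inv(2) by (auto simp: H_def)
    have the: "insert s (S - {s}) = S" "s \<in> X" "S - {s} \<subseteq> X - {s, a s}" "a ` (S - {s}) = S - {s}"
      if S: "S \<subseteq> X" "H S = {s}" for S s
    proof -
      have s: "s \<in> S" "a s \<notin> S" using S(2) by (auto simp: H_def)
      then show "insert s (S - {s}) = S" "s \<in> X" "S - {s} \<subseteq> X - {s, a s}" using S(1) by auto
      show "a ` (S - {s}) = S - {s}"
      proof (rule closed_imp_invariant[OF a])
        show "finite (S - {s})" using S(1) assms(2) finite_subset by auto
        fix x assume x: "x \<in> S - {s}"
        then have "a x \<in> S" using S(2) by (auto simp: H_def)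
        \<comment> \<open>Otherwise \<open>x\<close> would be \<open>a s\<close>, which lies outside
          \<open>S\<close>.\<close>
        moreover have "a x \<noteq> s" using inv(1)[of x] x s S(1) by auto
        ultimately show "a x \<in> S - {s}" by simp
      qed
    qed
    have "bij_betw (\<lambda>(s, P). insert s P) ?Z B"
    proof (rule bij_betw_byWitness[where f' = "\<lambda>S. (the_elem (H S), S - H S)"])
      show "\<forall>z\<in>?Z. (the_elem (H (case z of (s, P) \<Rightarrow> insert s P)),
          (case z of (s, P) \<Rightarrow> insert s P) - H (case z of (s, P) \<Rightarrow> insert s P)) = z"
        by (auto simp: H_insert)
      show "\<forall>S\<in>B. (case (the_elem (H S), S - H S) of (s, P) \<Rightarrow> insert s P) = S"
      proof
        fix S assume "S \<in> B"
        then obtain s where "S \<subseteq> X" "H S = {s}" by (auto simp: B_def)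
        then show "(case (the_elem (H S), S - H S) of (s, P) \<Rightarrow> insert s P) = S"
          using the(1)[of S s] by (simp del: insert_Diff_single)
      qed
      show "(\<lambda>(s, P). insert s P) ` ?Z \<subseteq> B"
      proof clarify
        fix s P assume *: "s \<in> X" "P \<subseteq> X - {s, a s}" "a ` P = P"
        then show "insert s P \<in> B" using H_insert[OF *] by (auto simp: B_def)
      qed
      show "(\<lambda>S. (the_elem (H S), S - H S)) ` B \<subseteq> ?Z"
      proof
        fix z assume "z \<in> (\<lambda>S. (the_elem (H S), S - H S)) ` B"
        then obtain S s where "S \<subseteq> X" "H S = {s}" "z = (s, S - {s})" by (auto simp: B_def)
        then show "z \<in> ?Z" using the(2-4)[of S s] by blast
      qed
    qed
    from sum.reindex_bij_betw[OF this, of h, symmetric]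
    show ?thesis by (simp add: case_prod_unfold)
  qed
  also have "\<dots> = (\<Sum>s\<in>X. \<Sum>P | P \<subseteq> X - {s, a s} \<and> a ` P = P. h (insert s P))"
    by (rule sum.Sigma[symmetric]) (use assms(2) in auto)
  finally show ?thesis by (simp add: A_def)
qed

text \<open>Invariant subsets choose among \<open>Suc k\<close> pairs. With one unmatched point
  \<open>s\<close>, only \<open>k\<close> pairs remain, and each of the \<open>2 * Suc k\<close>
  points \<open>s\<close> contributes the same amount. The factor \<open>y\<close> on the left comes
  from the merged cycle in that second case.\<close>

lemma sum_full_cycles_pochhammer:
  fixes y :: real
  assumes "a \<in> fpf_involutions X" "finite X" "card X = 2 * Suc k"
  defines "B \<equiv> \<lambda>m. pochhammer (- y) m * pochhammer y (2 * Suc k - m)"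
  shows "y * (real (2 * Suc k) * (\<Sum>b\<in>full_cycles X. y ^ num_cycles X (a \<circ> b)))
    = - (y * (\<Sum>j\<le>Suc k. real (Suc k choose j) * (real (2 * j) * ((-1) ^ j * B (2 * j)))))
      - real (2 * Suc k) * (\<Sum>j\<le>k. real (k choose j) * (real (2 * j + 1) * ((-1) ^ j * B (2 * j + 1))))"
proof -
  have a: "a permutes X" and inv: "\<And>i. i \<in> X \<Longrightarrow> a (a i) = i" "\<And>i. i \<in> X \<Longrightarrow> a i \<noteq> i"
    using assms by (auto simp: fpf_involutions_def)
  have ne: "X \<noteq> {}" using assms(3) by auto
  let ?h = "\<lambda>S. real (card S) * split_sum y X a S"
  \<comment> \<open>With \<open>j\<close> written as \<open>card S div 2\<close>, the summand
    depends on \<open>card S\<close> alone, so the subsets can be counted by size.\<close>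
  have "(\<Sum>S | S \<subseteq> X \<and> a ` S = S. ?h S)
    = (\<Sum>S | S \<subseteq> X \<and> a ` S = S. real (card S) * ((-1) ^ (card S div 2) * B (card S)))"
  proof (intro sum.cong refl)
    fix S assume "S \<in> {S. S \<subseteq> X \<and> a ` S = S}"
    then have S: "S \<subseteq> X" "a ` S = S" by auto
    have "card S = 2 * (card S div 2)" using fpf_involution_orbits[OF assms(1,2) S] by simp
    from split_sum_invariant[OF assms(1,2) S this, of y]
    show "?h S = real (card S) * ((-1) ^ (card S div 2) * B (card S))"
      by (simp add: B_def assms(3))
  qed
  also have "\<dots> = (\<Sum>j\<le>Suc k. real (Suc k choose j) * (real (2 * j) * ((-1) ^ j * B (2 * j))))"
    by (subst sum_invariant_subsets_fpf_involution[OF assms(1,2) subset_refl permutes_image[OF a] assms(3),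
          of "\<lambda>m. real m * ((-1) ^ (m div 2) * B m)"]) simp
  finally have 1: "(\<Sum>S | S \<subseteq> X \<and> a ` S = S. ?h S) = \<dots>" .
  have 2: "y * (\<Sum>P | P \<subseteq> X - {s, a s} \<and> a ` P = P. ?h (insert s P))
    = (\<Sum>j\<le>k. real (k choose j) * (real (2 * j + 1) * ((-1) ^ j * B (2 * j + 1))))" if s: "s \<in> X" for s
  proof -
    have as: "a s \<in> X" using s permutes_in_image[OF a] by blast
    have "a ` {s, a s} = {s, a s}" using inv(1)[OF s] by auto
    then have Y: "a ` (X - {s, a s}) = X - {s, a s}"
      using permutes_image[OF a] permutes_inj[OF a] by (simp add: image_set_diff)
    have cY: "card (X - {s, a s}) = 2 * k"
      using s as inv(2)[OF s] assms(2,3) by (simp add: card_Diff_subset)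
    have "y * (\<Sum>P | P \<subseteq> X - {s, a s} \<and> a ` P = P. ?h (insert s P))
      = (\<Sum>P | P \<subseteq> X - {s, a s} \<and> a ` P = P. real (card P + 1) * ((-1) ^ (card P div 2) * B (card P + 1)))"
      unfolding sum_distrib_left
    proof (intro sum.cong refl)
      fix P assume "P \<in> {P. P \<subseteq> X - {s, a s} \<and> a ` P = P}"
      then have P: "P \<subseteq> X - {s, a s}" "a ` P = P" by auto
      then have PX: "P \<subseteq> X" by auto
      have c: "card P = 2 * (card P div 2)" using fpf_involution_orbits[OF assms(1,2) PX P(2)] by simp
      have "finite P" "s \<notin> P" using PX P(1) assms(2) finite_subset by auto
      then have ci: "card (insert s P) = card P + 1" by simp
      show "y * ?h (insert s P) = real (card P + 1) * ((-1) ^ (card P div 2) * B (card P + 1))"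
        using split_sum_insert[OF assms(1,2) s P c, of y, folded c] 
        unfolding ci B_def assms(3) by (simp only: mult.left_commute[of y])
    qed
    also have "\<dots> = (\<Sum>j\<le>k. real (k choose j) * (real (2 * j + 1) * ((-1) ^ j * B (2 * j + 1))))"
      by (subst sum_invariant_subsets_fpf_involution[OF assms(1,2) Diff_subset Y cY,
          of "\<lambda>m. real (m + 1) * ((-1) ^ (m div 2) * B (m + 1))"]) simp
    finally show ?thesis .
  qed
  have "(\<Sum>S\<in>Pow X. ?h S) = (\<Sum>S | S \<subseteq> X \<and> a ` S = S. ?h S)
    + (\<Sum>s\<in>X. \<Sum>P | P \<subseteq> X - {s, a s} \<and> a ` P = P. ?h (insert s P))"
    by (rule sum_Pow_fpf_involution[OF assms(1,2)]) (simp add: split_sum_eq_0[OF assms(2) _ a])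
  then have "y * (\<Sum>S\<in>Pow X. ?h S)
    = y * (\<Sum>j\<le>Suc k. real (Suc k choose j) * (real (2 * j) * ((-1) ^ j * B (2 * j))))
      + (\<Sum>s\<in>X. \<Sum>j\<le>k. real (k choose j) * (real (2 * j + 1) * ((-1) ^ j * B (2 * j + 1))))"
    by (simp only: 1 distrib_left sum_distrib_left[of y _ X] 2 cong: sum.cong)
  then show ?thesis
    using sum_full_cycles_conv_split_sum[OF assms(2) ne, of y a] unfolding assms(3)
    by (simp add: assms(3))
qed

section \<open>From products with \<open>- y\<close> to products with \<open>1 - y\<close>\<close>

lemma pochhammer_split_recurrences:
  fixes y :: real
  assumes "Suc m \<le> N"
  defines "B \<equiv> \<lambda>m. pochhammer (- y) m * pochhammer y (N - m)"
    and "D \<equiv> \<lambda>m. pochhammer (1 - y) m * pochhammer y (N - m)"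
  shows "real N * B (Suc m) = - y * (D (Suc m) + D m)"
    and "y * (real N * B (Suc m)) = y * ((real N - real (Suc m)) * D (Suc m) - real (Suc m) * D m)"
proof -
  define R where "R = pochhammer (1 - y) m * pochhammer y (N - Suc m)"
  \<comment> \<open>\<open>B (Suc m)\<close>, \<open>D (Suc m)\<close> and \<open>D m\<close> are
    all multiples of \<open>R\<close> by linear polynomials in \<open>y\<close>, so both identities
    reduce to comparing these.\<close>
  have "N - m = Suc (N - Suc m)" using assms(1) by simp
  then have *: "pochhammer y (N - m) = pochhammer y (N - Suc m) * (y + (real N - real (Suc m)))"
    using assms(1) by (simp add: pochhammer_Suc of_nat_diff)
  have B: "B (Suc m) = - y * R"
    unfolding B_def R_def pochhammer_rec by simp
  have D1: "D (Suc m) = (real (Suc m) - y) * R"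
    unfolding D_def R_def pochhammer_Suc by (simp add: algebra_simps)
  have D0: "D m = (y + (real N - real (Suc m))) * R"
    unfolding D_def R_def * by (simp only: ac_simps)
  show "real N * B (Suc m) = - y * (D (Suc m) + D m)"
    unfolding B D1 D0 by (simp only: ring_distribs) (simp add: algebra_simps)
  show "y * (real N * B (Suc m)) = y * ((real N - real (Suc m)) * D (Suc m) - real (Suc m) * D m)"
    unfolding B D1 D0 by (simp add: algebra_simps)
qed

text \<open>Absorption turns \<open>(k choose i) * (k - i)\<close> into
  \<open>(k choose Suc i) * Suc i\<close>; shifting the index then flips the sign.\<close>

lemma sum_binomial_shift:
  fixes d :: "nat \<Rightarrow> real"
  shows "(\<Sum>i\<le>k. real (k choose i) * ((real k - real i) * ((-1) ^ i * d (Suc i))))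
    = - (\<Sum>i\<le>k. real (k choose i) * (real i * ((-1) ^ i * d i)))"
proof (cases k)
  case (Suc k')
  have absorb: "real (Suc k' choose i) * (real (Suc k') - real i) = real (Suc k' choose Suc i) * real (Suc i)"
    if "i \<le> k'" for i
  proof -
    have "real ((Suc k' - i) * (Suc k' choose i)) = real (Suc i * (Suc k' choose Suc i))"
      by (simp only: binomial_absorb_comp Suc_times_binomial diff_Suc_1)
    moreover have "real (Suc k' - i) = real (Suc k') - real i" using that by (simp add: of_nat_diff)
    ultimately show ?thesis by (simp only: of_nat_mult mult.commute)
  qed
  have "(\<Sum>i\<le>k. real (k choose i) * ((real k - real i) * ((-1) ^ i * d (Suc i))))
    = (\<Sum>i\<le>k'. real (Suc k' choose i) * (real (Suc k') - real i) * ((-1) ^ i * d (Suc i)))"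
    unfolding Suc by (simp add: mult.assoc)
  also have "\<dots> = (\<Sum>i\<le>k'. - (real (Suc k' choose Suc i) * (real (Suc i) * ((-1) ^ Suc i * d (Suc i)))))"
    by (intro sum.cong refl) (simp only: absorb atMost_iff, simp)
  also have "\<dots> = - (\<Sum>i\<le>k. real (k choose i) * (real i * ((-1) ^ i * d i)))"
    unfolding Suc by (subst sum.atMost_Suc_shift) (simp add: sum_negf)
  finally show ?thesis .
qed simp

text \<open>The recurrences replace each \<open>B\<close> by neighbouring values of
  \<open>D\<close>, the products that also arise from the generating function; collecting the
  multiples of each \<open>D\<close> then removes the linear weights.\<close>

lemma sum_full_cycles:
  fixes y :: real
  assumes "a \<in> fpf_involutions X" "finite X" "card X = 2 * n" "n \<ge> 1"
  defines "D \<equiv> \<lambda>m. pochhammer (1 - y) m * pochhammer y (2 * n - m)"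
  shows "real (2 * n) * (\<Sum>b\<in>full_cycles X. y ^ num_cycles X (a \<circ> b))
    = (\<Sum>j<n. (-1) ^ j * real ((n - 1) choose j) * (D (2 * j) - D (2 * j + 1)))"
proof (cases "y = 0")
  case True
  \<comment> \<open>The formula in terms of \<open>B\<close> carries a factor \<open>y\<close>, so
    \<open>y = 0\<close> is treated directly: both sides vanish, as every permutation of
    \<open>X\<close> has a cycle and \<open>pochhammer 0\<close> is zero at positive
    indices.\<close>
  have "X \<noteq> {}" using assms(3,4) by auto
  then have pow0: "(0 :: real) ^ num_cycles X g = 0" for g
    using assms(2) by (simp add: num_cycles_def card_gt_0_iff)
  have D0: "D m = 0" if "m < 2 * n" for m
    using that True by (simp add: D_def pochhammer_0_left)
  show ?thesis using True by (simp add: pow0 D0)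
next
  case False
  obtain k where n: "n = Suc k" using assms(4) by (cases n) auto
  define N where "N = 2 * Suc k"
  define B where "B m = pochhammer (- y) m * pochhammer y (N - m)" for m
  have D: "D m = pochhammer (1 - y) m * pochhammer y (N - m)" for m
    by (simp add: D_def N_def n)
  let ?f = "\<Sum>b\<in>full_cycles X. y ^ num_cycles X (a \<circ> b)"
  have rec1: "real N * B (2 * j + 1) = - y * (D (2 * j + 1) + D (2 * j))" if "j \<le> k" for j
    using pochhammer_split_recurrences(1)[of "2 * j" N y] that unfolding B_def D by (simp add: N_def)
  have rec2: "real N * B (2 * Suc j) = 2 * (real k - real j) * D (2 * Suc j) - real (2 * Suc j) * D (2 * j + 1)"
    if "j \<le> k" for j
  proof -
    have "y * (real N * B (Suc (2 * j + 1))) = y * ((real N - real (Suc (2 * j + 1))) * D (Suc (2 * j + 1))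
      - real (Suc (2 * j + 1)) * D (2 * j + 1))"
      unfolding B_def D by (rule pochhammer_split_recurrences(2)) (use that in \<open>simp add: N_def\<close>)
    then have "real N * B (2 * Suc j) = (real N - real (2 * Suc j)) * D (2 * Suc j) - real (2 * Suc j) * D (2 * j + 1)"
      using False by simp
    moreover have "real N - real (2 * Suc j) = 2 * (real k - real j)" by (simp add: N_def)
    ultimately show ?thesis by (simp only:)
  qed
  have shift: "(\<Sum>j\<le>Suc k. real (Suc k choose j) * (real (2 * j) * ((-1) ^ j * B (2 * j))))
    = - (\<Sum>j\<le>k. real (k choose j) * ((-1) ^ j * (real N * B (2 * Suc j))))"
  proof -
    \<comment> \<open>By absorption the weight \<open>2 * Suc j\<close> becomes the constant
      \<open>N\<close>, as needed for the recurrence of \<open>B (2 * Suc j)\<close>.\<close>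
    have "real (Suc k choose Suc j) * real (2 * Suc j) = real (k choose j) * real N" for j
    proof -
      have "real (Suc j * (Suc k choose Suc j)) = real (Suc k * (k choose j))"
        by (simp only: Suc_times_binomial)
      then show ?thesis by (simp add: N_def algebra_simps)
    qed
    then have summand: "real (Suc k choose Suc j) * (real (2 * Suc j) * ((-1) ^ Suc j * B (2 * Suc j)))
      = - (real (k choose j) * ((-1) ^ j * (real N * B (2 * Suc j))))" for j
      by (simp only: mult.assoc[symmetric]) simp
    show ?thesis by (subst sum.atMost_Suc_shift) (simp only: summand sum_negf)
  qed
  have "y * (real N * ?f) = y * (\<Sum>j\<le>k. real (k choose j) * ((-1) ^ j * (real N * B (2 * Suc j))))
      - (\<Sum>j\<le>k. real (k choose j) * (real (2 * j + 1) * ((-1) ^ j * (real N * B (2 * j + 1)))))"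
    using sum_full_cycles_pochhammer[OF assms(1,2), of k y] assms(3)
    unfolding n N_def[symmetric] B_def[symmetric] shift
    by (simp add: sum_distrib_left algebra_simps)
  also have "\<dots> = y * (\<Sum>j\<le>k. real (k choose j) * ((-1) ^ j * 
      (2 * (real k - real j) * D (2 * Suc j) - D (2 * j + 1) + real (2 * j + 1) * D (2 * j))))"
    unfolding sum_distrib_left sum_subtractf[symmetric]
    by (intro sum.cong refl) (simp only: rec1 rec2 atMost_iff, simp add: algebra_simps)
  finally have "real N * ?f = (\<Sum>j\<le>k. real (k choose j) * ((-1) ^ j * 
      (2 * (real k - real j) * D (2 * Suc j) - D (2 * j + 1) + real (2 * j + 1) * D (2 * j))))"
    using False by simp
  also have "\<dots> = 2 * (\<Sum>j\<le>k. real (k choose j) * ((real k - real j) * ((-1) ^ j * D (2 * Suc j))))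
     + (\<Sum>j\<le>k. real (k choose j) * ((-1) ^ j * (- D (2 * j + 1) + real (2 * j + 1) * D (2 * j))))"
    unfolding sum_distrib_left sum.distrib[symmetric]
    by (intro sum.cong refl) (simp add: algebra_simps)
  \<comment> \<open>The shift gives \<open>D (2 * j)\<close> the weight \<open>- 2 * j\<close>,
    which reduces its other weight \<open>2 * j + 1\<close> to one.\<close>
  also have "\<dots> = (\<Sum>j\<le>k. real (k choose j) * ((-1) ^ j * (D (2 * j) - D (2 * j + 1))))"
    unfolding sum_binomial_shift[where d = "\<lambda>i. D (2 * i)"] sum_distrib_left sum_negf[symmetric] sum.distrib[symmetric]
    by (intro sum.cong refl) (simp add: algebra_simps)
  finally show ?thesis
    unfolding n N_def lessThan_Suc_atMost by (simp add: ac_simps)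
qed

section \<open>Coefficients of the generating function\<close>

lemma card_full_cycles_fact:
  assumes "a \<in> fpf_involutions X" "finite X" "card X = 2 * n" "n \<ge> 1"
  shows "real (2 * n) * real (card (full_cycles X)) = fact (2 * n)"
proof -
  have "real (2 * n) * real (card (full_cycles X))
    = (\<Sum>j<n. (-1) ^ j * real ((n - 1) choose j) *
        (pochhammer 0 (2 * j) * pochhammer 1 (2 * n - 2 * j) - pochhammer 0 (2 * j + 1) * pochhammer 1 (2 * n - (2 * j + 1))))"
    using sum_full_cycles[OF assms, of 1] by simp
  \<comment> \<open>At \<open>y = 1\<close> the factor \<open>1 - y\<close> is zero, so only the
    rising factorial of index \<open>0\<close> survives.\<close>
  also have "\<dots> = (\<Sum>j<n. if j = 0 then fact (2 * n) else 0)"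
    by (intro sum.cong refl) (simp add: pochhammer_0_left pochhammer_fact[symmetric])
  also have "\<dots> = fact (2 * n)" using assms(4) by (simp add: sum.delta)
  finally show ?thesis .
qed

lemma fpf_involutions_nonempty:
  fixes n :: nat
  shows "fpf_involutions {1..2 * n} \<noteq> {}"
proof -
  \<comment> \<open>The involution exchanging \<open>1\<close> with \<open>2\<close>,
    \<open>3\<close> with \<open>4\<close>, and so on.\<close>
  define a where "a i = (if i \<in> {1..2 * n} then if odd i then i + 1 else i - 1 else i)" for i
  have inv: "a (a i) = i" for i
    unfolding a_def by (auto elim!: oddE evenE; presburger)
  have "a permutes {1..2 * n}"
    unfolding permutes_def using inv by (metis a_def)
  moreover have "a i \<noteq> i" if "i \<in> {1..2 * n}" for i using that by (auto simp: a_def)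
  ultimately have "a \<in> fpf_involutions {1..2 * n}" using inv by (simp add: fpf_involutions_def)
  then show ?thesis by blast
qed

section \<open>Expansion of the bivariate series\<close>

lemma fps_binomial_compose_uminus_nth:
  "fps_nth (fps_binomial z oo (- fps_X)) m = pochhammer (- z) m / fact m" for z :: real
proof -
  have "fps_nth (fps_binomial z oo (- fps_X)) m = (-1) ^ m * (z gchoose m)"
    by (simp add: fps_compose_uminus')
  then show ?thesis by (simp add: gbinomial_pochhammer)
qed

text \<open>Multiplication by \<open>fps_X * inverse (1 - fps_X)\<close> forms partial sums of
  coefficients. Its constant term is \<open>0\<close>, hence the strict bound
  \<open>b < l\<close>.\<close>

lemma GF_nth_nth:
  assumes "1 \<le> l" "l \<le> N"
  shows "fps_nth (fps_nth (GF y) N) l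
    = (\<Sum>b<l. pochhammer (- y) (N - b) / fact (N - b) * (pochhammer y b / fact b))"
proof -
  define u where "u m = pochhammer (- y) m / fact m" for m
  define v where "v m = pochhammer y m / fact m" for m
  define f where "f = (\<Sum>i=0..N. fps_const (u i * v (N - i)) * fps_X ^ (N - i))"
  define c :: "real fps" where "c = fps_X * inverse (1 - fps_X)"
  have U: "fps_nth (one_minus_x_pow y) m = fps_const (u m)" for m
    by (simp add: one_minus_x_pow_def fps_binomial_compose_uminus_nth u_def)
  have V: "fps_nth (one_minus_xxi_pow y) m = fps_const (v m) * fps_X ^ m" for m
    by (simp add: one_minus_xxi_pow_def fps_binomial_compose_uminus_nth v_def)
  have "fps_nth (GF y) N = c * fps_nth (one_minus_x_pow y * one_minus_xxi_pow y) N"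
    by (simp add: GF_def c_def mult.assoc)
  also have "fps_nth (one_minus_x_pow y * one_minus_xxi_pow y) N = f"
    by (simp add: fps_mult_nth U V f_def mult.assoc flip: fps_const_mult)
  finally have GF: "fps_nth (GF y) N = c * f" .
  have f: "fps_nth f b = u (N - b) * v b" if "b \<le> N" for b
  proof -
    \<comment> \<open>The inner exponent equals the power of \<open>x\<close> taken from the second
      factor, so only \<open>i = N - b\<close> contributes.\<close>
    have "fps_nth f b = (\<Sum>i=0..N. if i = N - b then u i * v (N - i) else 0)"
      unfolding f_def fps_sum_nth by (intro sum.cong refl) (use that in \<open>auto simp: fps_X_power_nth\<close>)
    then show ?thesis using that by simp
  qed
  have c: "c = Abs_fps (\<lambda>m. if m = 0 then 0 else 1)"
    unfolding c_def by (rule fps_ext) (simp add: fps_inverse_one_minus_fps_X)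
  have "fps_nth (c * f) l = (\<Sum>i=0..l. if i < l then fps_nth f i else 0)"
    unfolding mult.commute[of c] fps_mult_nth by (intro sum.cong refl) (auto simp: c)
  also have "\<dots> = (\<Sum>b<l. fps_nth f b)"
    by (intro sum.mono_neutral_cong_right) auto
  also have "\<dots> = (\<Sum>b<l. u (N - b) * v b)"
    by (intro sum.cong refl f) (use assms in simp)
  finally show ?thesis by (simp add: GF u_def v_def)
qed

text \<open>These are truncations of the Vandermonde convolution for \<open>(1-x)^y\<close> times
  \<open>(1-x)^(-y)\<close>. The closed form goes by induction on \<open>l\<close>: old value, added
  term and new value are all multiples of one product \<open>R\<close>.\<close>

lemma sum_pochhammer_convolution_partial:
  fixes y :: real
  assumes "1 \<le> l" "l \<le> N"
  shows "fact N * (\<Sum>b<l. pochhammer (- y) (N - b) / fact (N - b) * (pochhammer y b / fact b))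
    = - (real ((N - 1) choose (l - 1)) * (pochhammer (1 - y) (N - l) * pochhammer y l))"
  using assms
proof (induction l rule: nat_induct_at_least)
  case base
  then have N: "N = Suc (N - 1)" by simp
  have "pochhammer (- y) N = - y * pochhammer (1 - y) (N - 1)"
    by (subst N, subst pochhammer_rec) simp
  then show ?case by simp
next
  case (Suc l)
  obtain m where N: "N = Suc (l + m)" using Suc.prems by (metis add_Suc less_eqE)
  obtain l' where l: "l = Suc l'" using Suc.hyps by (cases l) auto
  define R where "R = pochhammer (1 - y) m * pochhammer y l"
  have 1: "pochhammer (- y) (N - l) * pochhammer y l = - y * R"
    unfolding N R_def by (simp add: pochhammer_rec)
  have 2: "pochhammer (1 - y) (N - l) * pochhammer y l = (real (Suc m) - y) * R"
    unfolding N R_def by (simp add: pochhammer_Suc algebra_simps)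
  have 3: "pochhammer (1 - y) (N - Suc l) * pochhammer y (Suc l) = (y + real l) * R"
    unfolding N R_def by (simp add: pochhammer_Suc algebra_simps)
  have binom: "fact N / (fact (N - l) * fact l) = real (N choose l)"
    using Suc.prems by (subst binomial_fact) (auto simp: mult.commute)
  have ch: "N choose l = ((N - 1) choose l) + ((N - 1) choose (l - 1))"
    unfolding N l by simp
  \<comment> \<open>Here \<open>Suc m\<close> is \<open>N - l\<close>.\<close>
  have absorb: "real l * real ((N - 1) choose l) = real (Suc m) * real ((N - 1) choose (l - 1))"
  proof -
    have "Suc l' * (Suc (l' + m) choose Suc l') = (Suc (l' + m) - l') * (Suc (l' + m) choose l')"
      by (simp only: binomial_absorb_comp Suc_times_binomial diff_Suc_1)
    then have "Suc l' * (Suc (l' + m) choose Suc l') = Suc m * (Suc (l' + m) choose l')"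
      by simp
    then have "real (Suc l' * (Suc (l' + m) choose Suc l')) = real (Suc m * (Suc (l' + m) choose l'))"
      by (simp only:)
    then show ?thesis unfolding N l by (simp only: of_nat_mult add_Suc diff_Suc_1)
  qed
  have "fact N * (\<Sum>b<Suc l. pochhammer (- y) (N - b) / fact (N - b) * (pochhammer y b / fact b))
    = - (real ((N - 1) choose (l - 1)) * ((real (Suc m) - y) * R))
      + fact N / (fact (N - l) * fact l) * (- y * R)"
    using Suc.IH Suc.prems unfolding sum.lessThan_Suc distrib_left 2 1[symmetric] by simp
  also have "\<dots> = - ((real ((N - 1) choose (l - 1)) * real (Suc m) + y * real ((N - 1) choose l)) * R)"
    unfolding binom ch by (simp add: algebra_simps)
  also have "\<dots> = - (real ((N - 1) choose l) * ((y + real l) * R))"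
    using absorb by (simp add: algebra_simps)
  finally show ?case unfolding 3 by simp
qed

section \<open>The weights \<open>F\<close> and the sum over hooks\<close>

lemma F_binomial:
  assumes "j < n"
  shows "F (2 * n) (2 * n - 2 * j) * real ((2 * n - 1) choose (2 * n - 2 * j - 1)) = (-1) ^ j * real ((n - 1) choose j)"
    and "F (2 * n) (2 * n - (2 * j + 1)) * real ((2 * n - 1) choose (2 * n - (2 * j + 1) - 1)) = (-1) ^ j * real ((n - 1) choose j)"
proof -
  have pos: "real ((2 * n - 1) choose (2 * n - 2 * j - 1)) \<noteq> 0"
    "real ((2 * n - 1) choose (2 * n - (2 * j + 1) - 1)) \<noteq> 0"
    using assms by auto
  have sym: "(n - 1) choose (n - 1 - j) = (n - 1) choose j"
    using assms by (intro binomial_symmetric[symmetric]) simp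
  have ev: "even (2 * n - 2 * j)" and od: "odd (2 * n - (2 * j + 1))" using assms by auto
  \<comment> \<open>For even \<open>l = 2 * n - 2 * j\<close> the dual value \<open>lu\<close> is
    \<open>2 * j + 1\<close>, which gives the sign exponent \<open>j\<close>.\<close>
  have e: "(2 * n + 1 - (2 * n - 2 * j) - 1) div 2 = j" "(2 * n - 2) div 2 = n - 1"
    "(2 * n - 2 * j - 2) div 2 = n - 1 - j" using assms by auto
  \<comment> \<open>For odd \<open>l\<close> it is \<open>2 * j + 2\<close>; the exponent
    \<open>j + 2\<close> gives the same sign as \<open>j\<close>.\<close>
  have o: "(2 * n + 1 - (2 * n - (2 * j + 1)) + 2) div 2 = j + 2"
    "(2 * n - (2 * j + 1) - 1) div 2 = n - 1 - j" using assms by auto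
  show "F (2 * n) (2 * n - 2 * j) * real ((2 * n - 1) choose (2 * n - 2 * j - 1)) = (-1) ^ j * real ((n - 1) choose j)"
    using pos(1) ev unfolding F_def Let_def e sym by simp
  show "F (2 * n) (2 * n - (2 * j + 1)) * real ((2 * n - 1) choose (2 * n - (2 * j + 1) - 1)) = (-1) ^ j * real ((n - 1) choose j)"
    using pos(2) od unfolding F_def Let_def o e(2) sym by simp
qed

lemma sum_lessThan_double: "(\<Sum>m<2 * n. g m) = (\<Sum>j<n. g (2 * j) + g (2 * j + 1))"
  for g :: "nat \<Rightarrow> 'a :: comm_monoid_add"
  by (induction n) (simp_all add: add.assoc)

text \<open>The binomial coefficient in the partial convolution cancels the denominator of
  \<open>F\<close>, and its minus sign turns the exponent \<open>N + 1 - l\<close> into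
  \<open>m = N - l\<close>. Grouping \<open>m\<close> as \<open>2 * j\<close> and
  \<open>2 * j + 1\<close> yields the differences of \<open>D\<close>.\<close>

lemma sum_hooks:
  fixes y :: real
  assumes "n \<ge> 1"
  defines "D \<equiv> \<lambda>m. pochhammer (1 - y) m * pochhammer y (2 * n - m)"
  shows "fact (2 * n) * (\<Sum>l = 1..2 * n. (-1) ^ (2 * n + 1 - l) * F (2 * n) l * fps_nth (fps_nth (GF y) (2 * n)) l)
    = (\<Sum>j<n. (-1) ^ j * real ((n - 1) choose j) * (D (2 * j) - D (2 * j + 1)))"
proof -
  define N where "N = 2 * n"
  have "fact N * (\<Sum>l = 1..N. (-1) ^ (N + 1 - l) * F N l * fps_nth (fps_nth (GF y) N) l)
    = (\<Sum>l = 1..N. (-1) ^ (N + 1 - l) * F N l * (fact N * fps_nth (fps_nth (GF y) N) l))"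
    by (simp add: sum_distrib_left ac_simps)
  also have "\<dots> = (\<Sum>l = 1..N. (-1) ^ (N - l) * (F N l * real ((N - 1) choose (l - 1))) * D (N - l))"
  proof (intro sum.cong refl)
    fix l assume "l \<in> {1..N}"
    then have l: "1 \<le> l" "l \<le> N" by auto
    have "N + 1 - l = Suc (N - l)" using l by simp
    then show "(-1) ^ (N + 1 - l) * F N l * (fact N * fps_nth (fps_nth (GF y) N) l)
      = (-1) ^ (N - l) * (F N l * real ((N - 1) choose (l - 1))) * D (N - l)"
      unfolding GF_nth_nth[OF l] sum_pochhammer_convolution_partial[OF l]
      using l by (simp add: D_def N_def)
  qed
  also have "\<dots> = (\<Sum>m<N. (-1) ^ m * (F N (N - m) * real ((N - 1) choose (N - m - 1))) * D m)"
    by (rule sum.reindex_bij_witness[of _ "\<lambda>m. N - m" "\<lambda>l. N - l"]) auto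
  also have "\<dots> = (\<Sum>j<n. (-1) ^ j * real ((n - 1) choose j) * (D (2 * j) - D (2 * j + 1)))"
    unfolding N_def sum_lessThan_double
    by (intro sum.cong refl) (simp only: F_binomial lessThan_iff, simp add: algebra_simps)
  finally show ?thesis by (simp only: N_def)
qed

theorem theorem2p1:
  fixes n :: nat and y :: real
  assumes "n \<ge> 1"
  defines "N \<equiv> 2 * n"
  shows "measure_pmf.expectation
           (pair_pmf (pmf_of_set (fpf_involutions {1..N})) (pmf_of_set (full_cycles {1..N})))
           (\<lambda>(a, b). y ^ num_cycles {1..N} (a \<circ> b))
         = (\<Sum>l = 1..N. (-1) ^ (N + 1 - l) * F N l * fps_nth (fps_nth (GF y) N) l)"
proof -
  let ?X = "{1..N}"
  let ?R = "\<Sum>l = 1..N. (-1) ^ (N + 1 - l) * F N l * fps_nth (fps_nth (GF y) N) l"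
  have "finite {b. b permutes ?X}" by (simp add: finite_permutations)
  then have fin: "finite (fpf_involutions ?X)" "finite (full_cycles ?X)"
    by (auto simp: fpf_involutions_def full_cycles_def intro: rev_finite_subset)
  obtain a0 where a0: "a0 \<in> fpf_involutions ?X" using fpf_involutions_nonempty[of n] by (auto simp: N_def)
  then have fne: "fpf_involutions ?X \<noteq> {}" by blast
  have N0: "real N \<noteq> 0" using assms by simp
  have card: "real N * real (card (full_cycles ?X)) = fact N"
    unfolding N_def by (rule card_full_cycles_fact[OF a0[unfolded N_def]]) (use assms in auto)
  have ne: "full_cycles ?X \<noteq> {}" using card by auto
  \<comment> \<open>The sum over full cycles is the same for every involution \<open>a\<close>, so
    averaging over \<open>a\<close> changes nothing.\<close>
  have inner: "(\<Sum>b\<in>full_cycles ?X. y ^ num_cycles ?X (a \<circ> b)) = real (card (full_cycles ?X)) * ?R"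
    if a: "a \<in> fpf_involutions ?X" for a
  proof -
    have "real N * (\<Sum>b\<in>full_cycles ?X. y ^ num_cycles ?X (a \<circ> b)) = fact N * ?R"
      unfolding N_def sum_hooks[OF assms(1)]
      by (rule sum_full_cycles[OF a[unfolded N_def]]) (use assms in auto)
    also have "\<dots> = real N * (real (card (full_cycles ?X)) * ?R)" using card by (simp add: mult.assoc[symmetric])
    finally show ?thesis using N0 by simp
  qed
  \<comment> \<open>Independent uniform choices are one uniform choice from the product set, so the
    expectation is a finite average.\<close>
  have "pair_pmf (pmf_of_set (fpf_involutions ?X)) (pmf_of_set (full_cycles ?X))
    = pmf_of_set (fpf_involutions ?X \<times> full_cycles ?X)"
  proof (rule pmf_eqI)
    fix z :: "(nat \<Rightarrow> nat) \<times> (nat \<Rightarrow> nat)"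
    show "pmf (pair_pmf (pmf_of_set (fpf_involutions ?X)) (pmf_of_set (full_cycles ?X))) z
      = pmf (pmf_of_set (fpf_involutions ?X \<times> full_cycles ?X)) z"
      using fin ne fne by (cases z) (simp add: pmf_pair card_cartesian_product indicator_times)
  qed
  then have "measure_pmf.expectation
      (pair_pmf (pmf_of_set (fpf_involutions ?X)) (pmf_of_set (full_cycles ?X)))
      (\<lambda>(a, b). y ^ num_cycles ?X (a \<circ> b))
    = (\<Sum>(a, b)\<in>fpf_involutions ?X \<times> full_cycles ?X. y ^ num_cycles ?X (a \<circ> b))
      / real (card (fpf_involutions ?X \<times> full_cycles ?X))"
    using fin ne fne by (simp add: integral_pmf_of_set)
  also have "\<dots> = (\<Sum>a\<in>fpf_involutions ?X. \<Sum>b\<in>full_cycles ?X. y ^ num_cycles ?X (a \<circ> b))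
      / (real (card (fpf_involutions ?X)) * real (card (full_cycles ?X)))"
    by (simp add: sum.cartesian_product card_cartesian_product)
  also have "\<dots> = ?R"
  proof -
    have "(\<Sum>a\<in>fpf_involutions ?X. \<Sum>b\<in>full_cycles ?X. y ^ num_cycles ?X (a \<circ> b))
      = (\<Sum>a\<in>fpf_involutions ?X. real (card (full_cycles ?X)) * ?R)"
      by (intro sum.cong refl inner)
    also have "\<dots> = real (card (fpf_involutions ?X)) * real (card (full_cycles ?X)) * ?R"
      by (simp only: sum_constant mult.assoc)
    finally show ?thesis using fin ne fne by simp
  qed
  finally show ?thesis .
qed

end
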